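(* Let $\mathcal{G}=(\mathcal{V},\mathcal{E},w)$ be a strongly connected directed graph with positive edge weights, and let $S_0,S_1\subseteq\mathcal{V}$ be disjoint non-empty leader sets. Consider either the absolute leader system or the influenced leader system on $\mathcal{G}$ with leader sets $S_0$ (opinion $0$) and $S_1$ (opinion $1$), and let $\mathcal{G}'$ be its leader-equivalent graph, with node set $\mathcal{V}'$ and leader nodes $s'_0,s'_1$. Then for every node $v\in\mathcal{V}'$ the steady-state value $\hat{x}_v$ is given by $$\hat{x}_{v} = \frac{b_{v,s'_0}^\top\,\mathcal{R}^{\mathcal{G}'}\,b_{s'_1,s'_0}}{b^\top_{s'_1,s'_0}\,\mathcal{R}^{\mathcal{G}'}\, b_{s'_1,s'_0}}= \frac{b_{v,s'_0}^\top(\mathcal{L}^{\mathcal{G}'})^{\dagger}b_{s'_1,s'_0}}{b^\top_{s'_1,s'_0}(\mathcal{L}^{\mathcal{G}'})^{\dagger} b_{s'_1,s'_0}} .$$ When $\mathcal{G}$ is undirected, this becomes $$\hat{x}_{v} = \frac{b_{v,s'_0}^\top(L^{\mathcal{G}'})^{\dagger} b_{s'_1,s'_0}}{b^\top_{s'_1,s'_0}(L^{\mathcal{G}'})^{\dagger} b_{s'_1,s'_0}} .$$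
   Context: Notation. For a weighted directed graph, $A$ is the adjacency matrix ($A_{u,v}=w(u,v)$ if $(u,v)\in\mathcal{E}$, else $0$), $D$ is the diagonal out-degree matrix $D_{u,u}=\sum_v A_{u,v}$, $L=D-A$ is the Laplacian, and $W=A^\top D^{-1}$ is the random walk transition matrix. An undirected graph is a directed graph with symmetric $A$. For a strongly connected graph, $\pi$ is the stationary distribution ($\pi=W\pi$, $\pi>0$, $\sum_v\pi_v=1$) and $\Pi=\mathrm{diag}(\pi)$. Define $\mathcal{L}=\Pi(I-W^\top)$ and $\mathcal{R}=(I-W^\top)^\dagger\Pi^{-1}$, where $\dagger$ is the Moore–Penrose pseudoinverse. A superscript indicates the graph to which a matrix belongs ($\Pi$, $\pi$ in $\mathcal{L}^{\mathcal{G}'}$, $\mathcal{R}^{\mathcal{G}'}$ are those of $\mathcal{G}'$). $e_u$ is the $u$-th standard basis vector and $b_{u,v}=e_u-e_v$. Absolute leader system: leaders in $S_0$ and $S_1$ hold the constant values $0$ and $1$, respectively; with $S=S_0\cup S_1$ and followers $F=\mathcal{V}\setminus S$, the dynamics are $\dot x_S=0$, $\dot{x}_F=-L_{F,F}x_F-L_{F,S}x_S$, and the steady state is $\hat x_v=0$ on $S_0$, $\hat x_v=1$ on $S_1$, $\hat x_F=-(L_{F,F})^{-1}L_{F,S}\hat x_S$. Leader-equivalent graph for the absolute leader system: $\mathcal{G}'$ is obtained from $\mathcal{G}$ by contracting $S_0$ to a single node $s'_0$ and $S_1$ to a single node $s'_1$, summing the weights of parallel edges in each direction and discarding edges inside $S_0$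 and inside $S_1$. So $\mathcal{V}'=F\cup\{s'_0,s'_1\}$, and for instance $w'(u,s'_i)=\sum_{v\in S_i}A_{u,v}$ for $u\in F$. Influenced leader system: each $v\in S_0\cup S_1$ has a stubbornness $\kappa_v>0$; with $K=\mathrm{diag}(\kappa_v)$ and $E^{T}$ the diagonal $0/1$ indicator matrix of a node set $T$, the dynamics are $\dot x=-(L+E^SK)x+E^{S_1}K\mathbf{1}$, and the steady state is $\hat x=(L+E^SK)^{-1}E^{S_1}K\mathbf{1}$. Leader-equivalent graph for the influenced leader system: $\mathcal{G}'$ is $\mathcal{G}$ together with two new nodes $s'_0,s'_1$ and, for $i\in\{0,1\}$ and each $u\in S_i$, the edges $(u,s'_i)$ and $(s'_i,u)$, both of weight $\kappa_u$. So $\mathcal{V}'=\mathcal{V}\cup\{s'_0,s'_1\}$. In both cases the values at the leader nodes of $\mathcal{G}'$ are $\hat x_{s'_0}=0$, $\hat x_{s'_1}=1$, and other nodes of $\mathcal{G}'$ keep their steady-state value from the original system. *)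

theory Defs
  imports Complex_Main "Graph_Theory.Pair_Digraph" "Graph_Theory.Digraph_Component"
begin

section \<open>Real matrices indexed by finite sets\<close>

text \<open>
  The matrices below are indexed by nodes and by subsets of nodes (the follower set, which may be
  empty, in particular), so they are functions of two indices and every operation that involves a
  summation carries the finite index set it ranges over. A submatrix such as \<open>L_{F,S}\<close> is the same
  function, used with the smaller index sets. Entries outside the index sets are irrelevant, except
  that objects defined by unique existence are normalised to vanish there.
\<close>

type_synonym ('a, 'b) rmat = "'a \<Rightarrow> 'b \<Rightarrow> real"

definition mmul :: "'b set \<Rightarrow> ('a, 'b) rmat \<Rightarrow> ('b, 'c) rmat \<Rightarrow> ('a, 'c) rmat" where
  "mmul J A B = (\<lambda>i k. \<Sum>j\<in>J. A i j * B j k)"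

definition mvec :: "'b set \<Rightarrow> ('a, 'b) rmat \<Rightarrow> ('b \<Rightarrow> real) \<Rightarrow> 'a \<Rightarrow> real" where
  "mvec J A x = (\<lambda>i. \<Sum>j\<in>J. A i j * x j)"

definition bilin :: "'a set \<Rightarrow> ('a \<Rightarrow> real) \<Rightarrow> ('a, 'a) rmat \<Rightarrow> ('a \<Rightarrow> real) \<Rightarrow> real" where
  "bilin I x A y = (\<Sum>i\<in>I. x i * mvec I A y i)"

definition madd :: "('a, 'b) rmat \<Rightarrow> ('a, 'b) rmat \<Rightarrow> ('a, 'b) rmat" where
  "madd A B = (\<lambda>i j. A i j + B i j)"

definition msub :: "('a, 'b) rmat \<Rightarrow> ('a, 'b) rmat \<Rightarrow> ('a, 'b) rmat" where
  "msub A B = (\<lambda>i j. A i j - B i j)"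

definition mtransp :: "('a, 'b) rmat \<Rightarrow> ('b, 'a) rmat" where
  "mtransp A = (\<lambda>i j. A j i)"

definition mdiag :: "('a \<Rightarrow> real) \<Rightarrow> ('a, 'a) rmat" where
  "mdiag d = (\<lambda>i j. if i = j then d i else 0)"

definition mid :: "('a, 'a) rmat" where
  "mid = mdiag (\<lambda>_. 1)"

definition eq_on :: "'a set \<Rightarrow> 'b set \<Rightarrow> ('a, 'b) rmat \<Rightarrow> ('a, 'b) rmat \<Rightarrow> bool" where
  "eq_on I J A B \<longleftrightarrow> (\<forall>i\<in>I. \<forall>j\<in>J. A i j = B i j)"

definition supported_on :: "'a set \<Rightarrow> 'b set \<Rightarrow> ('a, 'b) rmat \<Rightarrow> bool" where
  "supported_on I J A \<longleftrightarrow> (\<forall>i j. i \<notin> I \<or> j \<notin> J \<longrightarrow> A i j = 0)"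

definition is_minv :: "'a set \<Rightarrow> ('a, 'a) rmat \<Rightarrow> ('a, 'a) rmat \<Rightarrow> bool" where
  "is_minv I A B \<longleftrightarrow>
     supported_on I I B \<and> eq_on I I (mmul I A B) mid \<and> eq_on I I (mmul I B A) mid"

definition minv :: "'a set \<Rightarrow> ('a, 'a) rmat \<Rightarrow> ('a, 'a) rmat" where
  "minv I A = (THE B. is_minv I A B)"

text \<open>The Moore--Penrose pseudoinverse of a square real matrix, by the four Penrose conditions.\<close>

definition is_pinv :: "'a set \<Rightarrow> ('a, 'a) rmat \<Rightarrow> ('a, 'a) rmat \<Rightarrow> bool" where
  "is_pinv I A B \<longleftrightarrow>
     supported_on I I B \<and>
     eq_on I I (mmul I (mmul I A B) A) A \<and>
     eq_on I I (mmul I (mmul I B A) B) B \<and>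
     eq_on I I (mtransp (mmul I A B)) (mmul I A B) \<and>
     eq_on I I (mtransp (mmul I B A)) (mmul I B A)"

definition pinv :: "'a set \<Rightarrow> ('a, 'a) rmat \<Rightarrow> ('a, 'a) rmat" where
  "pinv I A = (THE B. is_pinv I A B)"


section \<open>Matrices of a weighted directed graph\<close>

definition adj :: "'a pair_pre_digraph \<Rightarrow> ('a \<times> 'a \<Rightarrow> real) \<Rightarrow> ('a, 'a) rmat" where
  "adj G w = (\<lambda>u v. if (u, v) \<in> parcs G then w (u, v) else 0)"

definition deg_mat :: "'a pair_pre_digraph \<Rightarrow> ('a \<times> 'a \<Rightarrow> real) \<Rightarrow> ('a, 'a) rmat" where
  "deg_mat G w = mdiag (\<lambda>u. \<Sum>v\<in>pverts G. adj G w u v)"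

definition laplacian :: "'a pair_pre_digraph \<Rightarrow> ('a \<times> 'a \<Rightarrow> real) \<Rightarrow> ('a, 'a) rmat" where
  "laplacian G w = msub (deg_mat G w) (adj G w)"

definition walk_mat :: "'a pair_pre_digraph \<Rightarrow> ('a \<times> 'a \<Rightarrow> real) \<Rightarrow> ('a, 'a) rmat" where
  "walk_mat G w = mmul (pverts G) (mtransp (adj G w)) (minv (pverts G) (deg_mat G w))"

definition undirected :: "'a pair_pre_digraph \<Rightarrow> ('a \<times> 'a \<Rightarrow> real) \<Rightarrow> bool" where
  "undirected G w \<longleftrightarrow> eq_on (pverts G) (pverts G) (mtransp (adj G w)) (adj G w)"

definition is_stationary ::
    "'a pair_pre_digraph \<Rightarrow> ('a \<times> 'a \<Rightarrow> real) \<Rightarrow> ('a \<Rightarrow> real) \<Rightarrow> bool" where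
  "is_stationary G w p \<longleftrightarrow>
     (\<forall>v. v \<notin> pverts G \<longrightarrow> p v = 0) \<and>
     (\<forall>v\<in>pverts G. p v = mvec (pverts G) (walk_mat G w) p v) \<and>
     (\<forall>v\<in>pverts G. p v > 0) \<and>
     (\<Sum>v\<in>pverts G. p v) = 1"

definition stationary :: "'a pair_pre_digraph \<Rightarrow> ('a \<times> 'a \<Rightarrow> real) \<Rightarrow> 'a \<Rightarrow> real" where
  "stationary G w = (THE p. is_stationary G w p)"

definition Pi_mat :: "'a pair_pre_digraph \<Rightarrow> ('a \<times> 'a \<Rightarrow> real) \<Rightarrow> ('a, 'a) rmat" where
  "Pi_mat G w = mdiag (stationary G w)"

definition calL :: "'a pair_pre_digraph \<Rightarrow> ('a \<times> 'a \<Rightarrow> real) \<Rightarrow> ('a, 'a) rmat" where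
  "calL G w = mmul (pverts G) (Pi_mat G w) (msub mid (mtransp (walk_mat G w)))"

definition calR :: "'a pair_pre_digraph \<Rightarrow> ('a \<times> 'a \<Rightarrow> real) \<Rightarrow> ('a, 'a) rmat" where
  "calR G w = mmul (pverts G)
     (pinv (pverts G) (msub mid (mtransp (walk_mat G w))))
     (minv (pverts G) (Pi_mat G w))"

definition unit_vec :: "'a \<Rightarrow> 'a \<Rightarrow> real" where
  "unit_vec u = (\<lambda>x. if x = u then 1 else 0)"

definition bvec :: "'a \<Rightarrow> 'a \<Rightarrow> 'a \<Rightarrow> real" where
  "bvec u v = (\<lambda>x. unit_vec u x - unit_vec v x)"


section \<open>Leader systems\<close>

text \<open>
  Nodes of a leader-equivalent graph: original nodes and the two new leaders
  \<open>s'_0\<close> (\<open>Lead0\<close>) and \<open>s'_1\<close> (\<open>Lead1\<close>).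
\<close>

datatype 'a lnode = Node 'a | Lead0 | Lead1

text \<open>The steady state on the nodes of the leader-equivalent graph.\<close>

fun extend_state :: "('a \<Rightarrow> real) \<Rightarrow> 'a lnode \<Rightarrow> real" where
  "extend_state x (Node v) = x v"
| "extend_state x Lead0 = 0"
| "extend_state x Lead1 = 1"

definition followers :: "'a pair_pre_digraph \<Rightarrow> 'a set \<Rightarrow> 'a set \<Rightarrow> 'a set" where
  "followers G S0 S1 = pverts G - (S0 \<union> S1)"

subsection \<open>Absolute leaders\<close>

definition leader_values :: "'a set \<Rightarrow> 'a \<Rightarrow> real" where
  "leader_values S1 = (\<lambda>v. if v \<in> S1 then 1 else 0)"

definition abs_steady ::
    "'a pair_pre_digraph \<Rightarrow> ('a \<times> 'a \<Rightarrow> real) \<Rightarrow> 'a set \<Rightarrow> 'a set \<Rightarrow> 'a \<Rightarrow> real" where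
  "abs_steady G w S0 S1 = (\<lambda>v.
     if v \<in> S0 \<union> S1 then leader_values S1 v
     else - mvec (followers G S0 S1) (minv (followers G S0 S1) (laplacian G w))
              (mvec (S0 \<union> S1) (laplacian G w) (leader_values S1)) v)"

definition contract :: "'a set \<Rightarrow> 'a set \<Rightarrow> 'a \<Rightarrow> 'a lnode" where
  "contract S0 S1 u = (if u \<in> S0 then Lead0 else if u \<in> S1 then Lead1 else Node u)"

definition abs_graph ::
    "'a pair_pre_digraph \<Rightarrow> 'a set \<Rightarrow> 'a set \<Rightarrow> 'a lnode pair_pre_digraph" where
  "abs_graph G S0 S1 =
     \<lparr> pverts = Node ` followers G S0 S1 \<union> {Lead0, Lead1},
       parcs = map_prod (contract S0 S1) (contract S0 S1) ` parcs G
                 - {(Lead0, Lead0), (Lead1, Lead1)} \<rparr>"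

definition abs_weight ::
    "'a pair_pre_digraph \<Rightarrow> ('a \<times> 'a \<Rightarrow> real) \<Rightarrow> 'a set \<Rightarrow> 'a set
      \<Rightarrow> 'a lnode \<times> 'a lnode \<Rightarrow> real" where
  "abs_weight G w S0 S1 a =
     (\<Sum>e\<in>{e \<in> parcs G. map_prod (contract S0 S1) (contract S0 S1) e = a}. w e)"

subsection \<open>Influenced leaders\<close>

definition indicator_mat :: "'a set \<Rightarrow> ('a, 'a) rmat" where
  "indicator_mat T = mdiag (\<lambda>v. if v \<in> T then 1 else 0)"

definition infl_steady ::
    "'a pair_pre_digraph \<Rightarrow> ('a \<times> 'a \<Rightarrow> real) \<Rightarrow> ('a \<Rightarrow> real) \<Rightarrow> 'a set \<Rightarrow> 'a set
      \<Rightarrow> 'a \<Rightarrow> real" where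
  "infl_steady G w \<kappa> S0 S1 =
     mvec (pverts G)
       (minv (pverts G)
          (madd (laplacian G w) (mmul (pverts G) (indicator_mat (S0 \<union> S1)) (mdiag \<kappa>))))
       (mvec (pverts G) (mmul (pverts G) (indicator_mat S1) (mdiag \<kappa>)) (\<lambda>_. 1))"

definition infl_graph ::
    "'a pair_pre_digraph \<Rightarrow> 'a set \<Rightarrow> 'a set \<Rightarrow> 'a lnode pair_pre_digraph" where
  "infl_graph G S0 S1 =
     \<lparr> pverts = Node ` pverts G \<union> {Lead0, Lead1},
       parcs = map_prod Node Node ` parcs G
                 \<union> (\<Union>u\<in>S0. {(Node u, Lead0), (Lead0, Node u)})
                 \<union> (\<Union>u\<in>S1. {(Node u, Lead1), (Lead1, Node u)}) \<rparr>"

text \<open>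
  The catch-all value is never used: only the values on the edges of \<^const>\<open>infl_graph\<close> matter.
\<close>

fun infl_weight ::
    "('a \<times> 'a \<Rightarrow> real) \<Rightarrow> ('a \<Rightarrow> real) \<Rightarrow> 'a lnode \<times> 'a lnode \<Rightarrow> real" where
  "infl_weight w \<kappa> (Node u, Node v) = w (u, v)"
| "infl_weight w \<kappa> (Node u, _) = \<kappa> u"
| "infl_weight w \<kappa> (_, Node u) = \<kappa> u"
| "infl_weight w \<kappa> _ = 0"

end

(*
  The leader-equivalent graph is again irreducible, and by construction the steady state is the
  function on its nodes that is harmonic (annihilated by the Laplacian) off the two leaders and takes
  the values 0 and 1 there; by the maximum principle this function is unique. Each of I - W^T,
  calL and, for undirected graphs, L is the Laplacian with its rows rescaled by nonzero factors, has
  the constants as kernel and a nowhere vanishing left null vector p. The right-hand side g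
  (Pi^{-1} b or b, with b = e_{s1} - e_{s0}) is orthogonal to p, hence lies in the range, so
  y = X^+ g solves X y = g. Thus y is harmonic off the leaders, and normalising it to the values 0
  and 1 at the leaders gives the steady state.
*)
theory Submission
  imports Defs
begin

section \<open>Inverses and pseudoinverses of finite matrices\<close>

text \<open>\<open>minv\<close>, \<open>pinv\<close> and \<open>stationary\<close> are definite
  descriptions, so nothing can be computed with them before existence and uniqueness are known. The
  linear algebra serves this purpose: invertibility follows from a trivial kernel by elimination,
  the pseudoinverse is written down for the one case that occurs, a one-dimensional kernel, and the
  stationary distribution starts from a left null vector of \<open>I - W^T\<close>. Irreducibility
  is phrased through sets closed under successors. In this form it passes to the contracted graph by
  taking preimages, and it applies directly to the maximisers of a harmonic function and to the
  complement of the zeros of a nonnegative invariant vector. The factor \<open>Pi^{-1}\<close> in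
  \<open>calR\<close> corrects the right-hand side: the left null vector of \<open>I - W^T\<close>
  is \<pi>, which is orthogonal to \<open>Pi^{-1} b\<close> but in general not to \<open>b\<close>.
  In \<open>calL\<close> the matrix itself carries the factor \<open>Pi\<close>, and its left null
  vector is constant.\<close>

lemma homogeneous_solution:
  fixes A :: "('a, 'b) rmat"
  assumes "finite I" "finite J" "card I < card J"
  shows "\<exists>z. (\<exists>j\<in>J. z j \<noteq> 0) \<and> (\<forall>i\<in>I. mvec J A z i = 0)"
  using assms
proof (induction I arbitrary: J A rule: finite_induct)
  case empty
  then have "J \<noteq> {}" by auto
  then show ?case by (intro exI[of _ "\<lambda>_. 1"]) auto
next
  case (insert i I)
  show ?case
  proof (cases "\<forall>j\<in>J. A i j = 0")
    case True
    obtain z where "\<exists>j\<in>J. z j \<noteq> 0" "\<forall>k\<in>I. mvec J A z k = 0"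
      using insert.IH[of J A] insert.prems insert.hyps by auto
    then show ?thesis using True by (intro exI[of _ z]) (auto simp: mvec_def)
  next
    case False
    then obtain j0 where j0: "j0 \<in> J" "A i j0 \<noteq> 0" by blast
    define K where "K = J - {j0}"
    have K: "finite K" "j0 \<notin> K" "J = insert j0 K" "card I < card K"
      using insert.prems insert.hyps j0 by (auto simp: K_def)
    \<comment> \<open>Elimination with pivot \<open>A i j0\<close>: clearing column
      \<open>j0\<close> by row \<open>i\<close> leaves one equation and one unknown fewer, so the
      strict inequality of cardinalities survives.\<close>
    obtain z where z: "\<exists>j\<in>K. z j \<noteq> 0"
      "\<forall>k\<in>I. mvec K (\<lambda>k j. A k j - A k j0 / A i j0 * A i j) z k = 0"
      using insert.IH[OF K(1,4)] by blast
    \<comment> \<open>Back substitution: \<open>c\<close> is the value of unknown \<open>j0\<close>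
      that equation \<open>i\<close> forces.\<close>
    define c where "c = - (mvec K A z i) / A i j0"
    have row: "mvec J A (z(j0 := c)) k = A k j0 * c + mvec K A z k" for k
    proof -
      have "mvec K A (z(j0 := c)) k = mvec K A z k"
        unfolding mvec_def using K(2) by (intro sum.cong) auto
      then show ?thesis using K by (simp add: mvec_def)
    qed
    have "mvec K (\<lambda>k j. A k j - A k j0 / A i j0 * A i j) z k
        = mvec K A z k - A k j0 / A i j0 * mvec K A z i" for k
      by (simp add: mvec_def left_diff_distrib sum_subtractf sum_distrib_left mult.assoc)
    then have "mvec J A (z(j0 := c)) k = 0" if "k \<in> insert i I" for k
      using that z(2) j0(2) unfolding row by (auto simp: c_def)
    moreover have "\<exists>j\<in>J. (z(j0 := c)) j \<noteq> 0"
      using z(1) K by auto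
    ultimately show ?thesis by blast
  qed
qed

section \<open>Matrix algebra up to equality on index sets\<close>

lemma mtransp_mtransp [simp]: "mtransp (mtransp A) = A"
  by (simp add: mtransp_def)

lemma mmul_assoc:
  "finite J \<Longrightarrow> finite K \<Longrightarrow> mmul K (mmul J A B) C = mmul J A (mmul K B C)"
  unfolding mmul_def
  by (intro ext) (simp add: sum_distrib_left sum_distrib_right mult.assoc, rule sum.swap)

lemma mvec_mmul:
  "finite J \<Longrightarrow> finite K \<Longrightarrow> mvec K (mmul J A B) x = mvec J A (mvec K B x)"
  unfolding mmul_def mvec_def
  by (intro ext) (simp add: sum_distrib_left sum_distrib_right mult.assoc, rule sum.swap)

lemma mmul_column: "mmul J A B i k = mvec J A (\<lambda>j. B j k) i"
  by (simp add: mmul_def mvec_def)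

lemma mvec_cong:
  "(\<And>j. j \<in> J \<Longrightarrow> A i j = A' i j) \<Longrightarrow> (\<And>j. j \<in> J \<Longrightarrow> x j = y j) \<Longrightarrow>
    mvec J A x i = mvec J A' y i"
  by (simp add: mvec_def)

lemma mvec_mid [simp]: "finite I \<Longrightarrow> i \<in> I \<Longrightarrow> mvec I mid x i = x i"
  by (simp add: mvec_def mid_def mdiag_def if_distrib[of "\<lambda>c. c * _"] cong: if_cong)

lemma mtransp_mmul: "mtransp (mmul J A B) = mmul J (mtransp B) (mtransp A)"
  by (simp add: mtransp_def mmul_def mult.commute)

lemma eq_on_refl [simp]: "eq_on I J A A"
  by (simp add: eq_on_def)

lemma eq_on_sym: "eq_on I J A B \<Longrightarrow> eq_on I J B A"
  by (simp add: eq_on_def)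

lemma eq_on_trans [trans]: "eq_on I J A B \<Longrightarrow> eq_on I J B C \<Longrightarrow> eq_on I J A C"
  by (simp add: eq_on_def)

lemma eq_on_mmul:
  "eq_on I J A A' \<Longrightarrow> eq_on J K B B' \<Longrightarrow> eq_on I K (mmul J A B) (mmul J A' B')"
  by (simp add: eq_on_def mmul_def)

lemma eq_on_mtransp: "eq_on I J A B \<Longrightarrow> eq_on J I (mtransp A) (mtransp B)"
  by (simp add: eq_on_def mtransp_def)

lemma supported_on_eqI:
  assumes "supported_on I J A" "supported_on I J B" "eq_on I J A B"
  shows "A = B"
proof (intro ext)
  show "A i j = B i j" for i j
    using assms unfolding supported_on_def eq_on_def by (cases "i \<in> I \<and> j \<in> J") auto
qed

lemma mmul_mid_left: "finite I \<Longrightarrow> eq_on I J (mmul I mid A) A"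
  by (simp add: eq_on_def mmul_column)

lemma mmul_mid_right: "finite I \<Longrightarrow> eq_on J I (mmul I A mid) A"
  by (simp add: eq_on_def mmul_def mid_def mdiag_def if_distrib[of "\<lambda>c. _ * c"] cong: if_cong)

section \<open>Inverses, and the uniqueness of inverse and pseudoinverse\<close>

lemma minv_eqI:
  assumes fin: "finite I" and B: "is_minv I A B"
  shows "minv I A = B"
  unfolding minv_def
proof (rule the_equality, rule B)
  fix C assume C: "is_minv I A C"
  have "eq_on I I C (mmul I C mid)"
    by (rule eq_on_sym[OF mmul_mid_right[OF fin]])
  also have "eq_on I I \<dots> (mmul I C (mmul I A B))"
    using B by (intro eq_on_mmul) (auto simp: is_minv_def intro: eq_on_sym)
  also have "mmul I C (mmul I A B) = mmul I (mmul I C A) B"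
    by (simp add: mmul_assoc fin)
  also have "eq_on I I \<dots> (mmul I mid B)"
    using C by (intro eq_on_mmul) (auto simp: is_minv_def)
  also have "eq_on I I \<dots> B"
    by (rule mmul_mid_left[OF fin])
  finally show "C = B"
    using B C supported_on_eqI unfolding is_minv_def by blast
qed

text \<open>Each column of the inverse solves an inhomogeneous system. Giving the right-hand side an
  unknown coefficient of its own (index \<open>None\<close>) makes it homogeneous with one unknown
  too many, so counting suffices.\<close>

lemma is_minv_exists:
  fixes A :: "('a, 'a) rmat"
  assumes fin: "finite I"
    and inj: "\<And>z. (\<And>i. i \<in> I \<Longrightarrow> mvec I A z i = 0) \<Longrightarrow> (\<And>i. i \<in> I \<Longrightarrow> z i = 0)"
  shows "\<exists>B. is_minv I A B"
proof -
  have "\<exists>z. \<forall>i\<in>I. mvec I A z i = mid i k" for k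
  proof -
    define J where "J = insert None (Some ` I)"
    define A' where "A' = (\<lambda>i. case_option (- mid i k) (A i))"
    have "card I < card J" "finite J"
      using fin by (auto simp: J_def card_insert_if card_image)
    from homogeneous_solution[OF fin this(2,1), of A']
    obtain z where z: "\<exists>j\<in>J. z j \<noteq> 0" "\<forall>i\<in>I. mvec J A' z i = 0"
      by blast
    have "mvec J A' z i = - mid i k * z None + mvec I A (\<lambda>j. z (Some j)) i" for i
      using fin by (simp add: mvec_def J_def A'_def sum.reindex)
    with z(2) have eq: "mvec I A (\<lambda>j. z (Some j)) i = mid i k * z None" if "i \<in> I" for i
      using that by auto
    \<comment> \<open>Otherwise the remaining entries would be a nonzero kernel vector of
      \<open>A\<close>.\<close>
    have "z None \<noteq> 0"
    proof
      assume "z None = 0"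
      then have "z (Some i) = 0" if "i \<in> I" for i
        using inj[of "\<lambda>j. z (Some j)"] eq that by auto
      with z(1) \<open>z None = 0\<close> show False by (auto simp: J_def)
    qed
    then have "mvec I A (\<lambda>j. z (Some j) / z None) i = mid i k" if "i \<in> I" for i
      using eq[OF that] by (simp add: mvec_def sum_divide_distrib[symmetric])
    then show ?thesis by blast
  qed
  then obtain Z where Z: "\<And>k i. i \<in> I \<Longrightarrow> mvec I A (Z k) i = mid i k"
    by metis
  define B where "B = (\<lambda>j k. if j \<in> I \<and> k \<in> I then Z k j else 0)"
  have right: "eq_on I I (mmul I A B) mid"
    unfolding eq_on_def
  proof (intro ballI)
    fix i k assume "i \<in> I" "k \<in> I"
    then have "mmul I A B i k = mvec I A (Z k) i"
      unfolding mmul_column by (intro mvec_cong) (auto simp: B_def)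
    then show "mmul I A B i k = mid i k" using Z \<open>i \<in> I\<close> by simp
  qed
  have "eq_on I I (mmul I B A) mid"
    unfolding eq_on_def
  proof (intro ballI)
    fix i k assume i: "i \<in> I" and k: "k \<in> I"
    \<comment> \<open>\<open>A (B A - I) = (A B) A - A = 0\<close> column by column, so by
      injectivity the right inverse is also a left inverse.\<close>
    have "mvec I A (\<lambda>j. mmul I B A j k - mid j k) i' = 0" if "i' \<in> I" for i'
    proof -
      have "mvec I A (\<lambda>j. mmul I B A j k - mid j k) i' = mmul I A (mmul I B A) i' k - mmul I A mid i' k"
        by (simp add: mvec_def mmul_def right_diff_distrib sum_subtractf)
      also have "mmul I A (mmul I B A) = mmul I (mmul I A B) A"
        by (simp add: mmul_assoc fin)
      also have "\<dots> i' k = A i' k"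
        using eq_on_trans[OF eq_on_mmul[OF right eq_on_refl[of I I A]] mmul_mid_left[OF fin]] that k
        by (simp add: eq_on_def)
      also have "mmul I A mid i' k = A i' k"
        using mmul_mid_right[OF fin, of "{i'}" A] k by (simp add: eq_on_def)
      finally show ?thesis by simp
    qed
    from inj[OF this i] show "mmul I B A i k = mid i k" by simp
  qed
  with right show ?thesis
    by (intro exI[of _ B]) (auto simp: is_minv_def supported_on_def B_def)
qed

lemma mvec_minv:
  assumes "finite I" "\<exists>B. is_minv I A B" "i \<in> I"
  shows "mvec I A (mvec I (minv I A) x) i = x i"
proof -
  obtain B where B: "is_minv I A B" using assms(2) by blast
  then have "mvec I A (mvec I B x) i = mvec I mid x i"
    unfolding mvec_mmul[OF assms(1,1), symmetric]
    using assms(3) by (intro mvec_cong) (auto simp: is_minv_def eq_on_def)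
  then show ?thesis using assms minv_eqI[OF assms(1) B] by simp
qed

text \<open>Without such a \<open>p\<close> the transpose would have trivial kernel and hence an
  inverse; transposed back, this is a left inverse of \<open>A\<close> and forces \<open>z\<close>
  to vanish.\<close>

lemma left_null_vector:
  fixes A :: "('a, 'a) rmat"
  assumes fin: "finite I" and z: "\<And>i. i \<in> I \<Longrightarrow> mvec I A z i = 0" and k: "k \<in> I" "z k \<noteq> 0"
  shows "\<exists>p. (\<exists>i\<in>I. p i \<noteq> 0) \<and> (\<forall>j\<in>I. mvec I (mtransp A) p j = 0)"
proof (rule ccontr)
  assume "\<not> ?thesis"
  then obtain B where B: "is_minv I (mtransp A) B"
    using is_minv_exists[OF fin, of "mtransp A"] by blast
  have "z k = mvec I mid z k" using fin k by simp
  also have "\<dots> = mvec I (mmul I (mtransp B) A) z k"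
  proof (intro mvec_cong)
    fix j assume "j \<in> I"
    then have "mmul I (mtransp A) B j k = mid j k"
      using B k by (simp add: is_minv_def eq_on_def)
    then show "mid k j = mmul I (mtransp B) A k j"
      by (simp add: mmul_def mtransp_def mid_def mdiag_def mult.commute eq_commute)
  qed simp
  also have "\<dots> = mvec I (mtransp B) (mvec I A z) k"
    by (simp add: mvec_mmul fin)
  also have "\<dots> = 0" using z by (simp add: mvec_def[of _ "mtransp B"])
  finally show False using k by simp
qed

text \<open>Both products are the orthogonal projection onto the range of \<open>A\<close>: \<open>A
  B = (A B)^T = (A C A B)^T = (A B)^T (A C)^T = A B A C = A C\<close>.\<close>

lemma is_pinv_mmul_left_unique:
  assumes fin: "finite I" and B: "is_pinv I A B" and C: "is_pinv I A C"
  shows "eq_on I I (mmul I A B) (mmul I A C)"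
proof -
  have B1: "eq_on I I (mmul I (mmul I A B) A) A" "eq_on I I (mtransp (mmul I A B)) (mmul I A B)"
    and C1: "eq_on I I (mmul I (mmul I A C) A) A" "eq_on I I (mtransp (mmul I A C)) (mmul I A C)"
    using B C by (auto simp: is_pinv_def)
  have "eq_on I I (mmul I A B) (mtransp (mmul I A B))"
    by (rule eq_on_sym[OF B1(2)])
  also have "eq_on I I \<dots> (mtransp (mmul I (mmul I (mmul I A C) A) B))"
    by (intro eq_on_mtransp eq_on_mmul eq_on_refl eq_on_sym[OF C1(1)])
  also have "\<dots> = mmul I (mtransp (mmul I A B)) (mtransp (mmul I A C))"
    by (simp only: mtransp_mmul[symmetric] mmul_assoc[OF fin fin])
  also have "eq_on I I \<dots> (mmul I (mmul I A B) (mmul I A C))"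
    by (intro eq_on_mmul B1 C1)
  also have "\<dots> = mmul I (mmul I (mmul I A B) A) C"
    by (simp only: mmul_assoc[OF fin fin])
  also have "eq_on I I \<dots> (mmul I A C)"
    by (intro eq_on_mmul eq_on_refl B1)
  finally show ?thesis .
qed

text \<open>Transposition exchanges the two products, so uniqueness of \<open>A B\<close> also
  yields that of \<open>B A\<close>.\<close>

lemma is_pinv_mtransp: "is_pinv I A B \<Longrightarrow> finite I \<Longrightarrow> is_pinv I (mtransp A) (mtransp B)"
proof -
  assume "is_pinv I A B" and fin: "finite I"
  then have B: "supported_on I I B" "eq_on I I (mmul I A (mmul I B A)) A"
    "eq_on I I (mmul I B (mmul I A B)) B"
    "eq_on I I (mtransp (mmul I A B)) (mmul I A B)"
    "eq_on I I (mtransp (mmul I B A)) (mmul I B A)"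
    by (auto simp: is_pinv_def mmul_assoc)
  have "supported_on I I (mtransp B)"
    using B(1) by (auto simp: supported_on_def mtransp_def)
  then show ?thesis
    using B(2-5)[THEN eq_on_mtransp]
    by (simp add: is_pinv_def mtransp_mmul mmul_assoc[OF fin fin])
qed

lemma pinv_eqI:
  assumes fin: "finite I" and B: "is_pinv I A B"
  shows "pinv I A = B"
  unfolding pinv_def
proof (rule the_equality, rule B)
  fix C assume C: "is_pinv I A C"
  have left: "eq_on I I (mmul I A C) (mmul I A B)"
    by (rule is_pinv_mmul_left_unique[OF fin C B])
  have right: "eq_on I I (mmul I C A) (mmul I B A)"
    using is_pinv_mmul_left_unique[OF fin is_pinv_mtransp[OF C fin] is_pinv_mtransp[OF B fin],
      THEN eq_on_mtransp]
    by (simp add: mtransp_mmul)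
  \<comment> \<open>\<open>C = C A C = B A C = B A B = B\<close>.\<close>
  have "eq_on I I C (mmul I (mmul I C A) C)"
    using C by (auto simp: is_pinv_def intro: eq_on_sym)
  also have "eq_on I I \<dots> (mmul I (mmul I B A) C)"
    by (intro eq_on_mmul right eq_on_refl)
  also have "\<dots> = mmul I B (mmul I A C)"
    by (simp only: mmul_assoc[OF fin fin])
  also have "eq_on I I \<dots> (mmul I B (mmul I A B))"
    by (intro eq_on_mmul left eq_on_refl)
  also have "\<dots> = mmul I (mmul I B A) B"
    by (simp only: mmul_assoc[OF fin fin])
  also have "eq_on I I \<dots> B"
    using B by (simp add: is_pinv_def)
  finally show "C = B"
    using B C supported_on_eqI unfolding is_pinv_def by blast
qed

section \<open>The pseudoinverse of a matrix with one-dimensional kernel\<close>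

lemma mvec_diff: "mvec J A (\<lambda>j. x j - y j) i = mvec J A x i - mvec J A y i"
  by (simp add: mvec_def right_diff_distrib sum_subtractf)

lemma mvec_scale: "mvec J A (\<lambda>j. c * x j) i = c * mvec J A x i"
  by (simp add: mvec_def sum_distrib_left mult.left_commute)

lemma sum_mid_left: "finite I \<Longrightarrow> i \<in> I \<Longrightarrow> (\<Sum>j\<in>I. mid i j * f j) = f i"
  using mvec_mid[of I i f] by (simp add: mvec_def)

lemma sum_mid_right: "finite I \<Longrightarrow> k \<in> I \<Longrightarrow> (\<Sum>j\<in>I. f j * mid j k) = f k"
  by (simp add: mid_def mdiag_def if_distrib[of "\<lambda>c. _ * c"] cong: if_cong)

text \<open>
  The kernel of \<open>A\<close> is spanned by \<open>u\<close> and that of its transpose by \<open>p\<close>, so \<open>N = A + p u\<^sup>T\<close> is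
  invertible, and subtracting \<open>u p\<^sup>T / (|u|\<^sup>2 |p|\<^sup>2)\<close> from its inverse gives the pseudoinverse of \<open>A\<close>.
\<close>

lemma corank_one_pinv:
  fixes A :: "('a, 'a) rmat"
  assumes fin: "finite I"
    and ker: "\<And>z. (\<And>i. i \<in> I \<Longrightarrow> mvec I A z i = 0) \<Longrightarrow> \<exists>c. \<forall>i\<in>I. z i = c * u i"
    and Au: "\<And>i. i \<in> I \<Longrightarrow> mvec I A u i = 0"
    and pA: "\<And>j. j \<in> I \<Longrightarrow> mvec I (mtransp A) p j = 0"
    and u: "\<exists>i\<in>I. u i \<noteq> 0" and p: "\<exists>i\<in>I. p i \<noteq> 0"
    and g: "(\<Sum>i\<in>I. p i * g i) = 0" and "i \<in> I"
  shows "mvec I A (mvec I (pinv I A) g) i = g i"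
proof -
  define \<alpha> \<beta> where "\<alpha> = (\<Sum>i\<in>I. u i * u i)" and "\<beta> = (\<Sum>i\<in>I. p i * p i)"
  have \<alpha>: "\<alpha> \<noteq> 0" and \<beta>: "\<beta> \<noteq> 0"
    using u p by (auto simp: \<alpha>_def \<beta>_def sum_nonneg_eq_0_iff fin)
  define N where "N = madd A (\<lambda>i j. p i * u j)"
  have mvec_N: "mvec I N z i = mvec I A z i + p i * (\<Sum>j\<in>I. u j * z j)" for z i
    by (simp add: N_def madd_def mvec_def distrib_right sum.distrib sum_distrib_left mult.assoc)
  have pA': "(\<Sum>i\<in>I. p i * A i j) = 0" if "j \<in> I" for j
    using pA[OF that] by (simp add: mvec_def mtransp_def mult.commute)
  have pN: "(\<Sum>i\<in>I. p i * N i j) = \<beta> * u j" if "j \<in> I" for j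
    using pA'[OF that]
    by (simp add: N_def madd_def distrib_left sum.distrib \<beta>_def sum_distrib_right mult.assoc)
  have "\<exists>C. is_minv I N C"
  proof (rule is_minv_exists[OF fin])
    fix z i assume z: "\<And>i. i \<in> I \<Longrightarrow> mvec I N z i = 0" and "i \<in> I"
    \<comment> \<open>Applying \<open>p^T\<close> kills \<open>A\<close> and leaves \<beta> times
      \<open>u^T z\<close>. Hence \<open>u^T z = 0\<close> and \<open>A z = 0\<close>, so
      \<open>z\<close> is a multiple of \<open>u\<close> orthogonal to \<open>u\<close>.\<close>
    have "0 = (\<Sum>i\<in>I. p i * mvec I N z i)" using z by simp
    also have "\<dots> = (\<Sum>j\<in>I. (\<Sum>i\<in>I. p i * N i j) * z j)"
      by (simp add: mvec_def sum_distrib_left sum_distrib_right mult.assoc) (rule sum.swap)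
    also have "\<dots> = \<beta> * (\<Sum>j\<in>I. u j * z j)"
      by (simp add: pN sum_distrib_left mult.assoc)
    finally have uz: "(\<Sum>j\<in>I. u j * z j) = 0" using \<beta> by simp
    then have "mvec I A z i = 0" if "i \<in> I" for i
      using z[OF that] by (simp add: mvec_N)
    from ker[OF this] obtain c where c: "\<And>i. i \<in> I \<Longrightarrow> z i = c * u i" by blast
    then have "0 = c * \<alpha>"
      using uz by (simp add: \<alpha>_def sum_distrib_left mult.left_commute)
    then show "z i = 0" using \<alpha> c \<open>i \<in> I\<close> by simp
  qed
  then obtain C where "is_minv I N C" ..
  then have NC: "\<And>i k. i \<in> I \<Longrightarrow> k \<in> I \<Longrightarrow> (\<Sum>j\<in>I. N i j * C j k) = mid i k"
    and CN: "\<And>i k. i \<in> I \<Longrightarrow> k \<in> I \<Longrightarrow> (\<Sum>j\<in>I. C i j * N j k) = mid i k"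
    by (auto simp: is_minv_def eq_on_def mmul_def)
  \<comment> \<open>Multiply \<open>p^T N = \<beta> u^T\<close> by \<open>C\<close> from the right;
    \<open>Cp\<close> arises in the same way from \<open>N u = \<alpha> p\<close>.\<close>
  have uC: "(\<Sum>j\<in>I. u j * C j k) = p k / \<beta>" if "k \<in> I" for k
  proof -
    have "\<beta> * (\<Sum>j\<in>I. u j * C j k) = (\<Sum>j\<in>I. (\<Sum>i\<in>I. p i * N i j) * C j k)"
      by (simp add: pN sum_distrib_left mult.assoc)
    also have "\<dots> = (\<Sum>i\<in>I. p i * (\<Sum>j\<in>I. N i j * C j k))"
      by (simp add: sum_distrib_left sum_distrib_right mult.assoc) (rule sum.swap)
    also have "\<dots> = p k" by (simp add: NC that fin sum_mid_right)
    finally show ?thesis using \<beta> by (simp add: field_simps)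
  qed
  have Cp: "(\<Sum>j\<in>I. C i j * p j) = u i / \<alpha>" if "i \<in> I" for i
  proof -
    have "\<alpha> * (\<Sum>j\<in>I. C i j * p j) = (\<Sum>j\<in>I. C i j * mvec I N u j)"
      by (simp add: mvec_N Au sum_distrib_left \<alpha>_def[symmetric] mult_ac)
    also have "\<dots> = (\<Sum>k\<in>I. (\<Sum>j\<in>I. C i j * N j k) * u k)"
      by (simp add: mvec_def sum_distrib_left sum_distrib_right mult.assoc) (rule sum.swap)
    also have "\<dots> = u i" by (simp add: CN that fin sum_mid_left)
    finally show ?thesis using \<alpha> by (simp add: field_simps)
  qed
  define B where "B = (\<lambda>i k. if i \<in> I \<and> k \<in> I then C i k - u i * p k / (\<alpha> * \<beta>) else 0)"
  \<comment> \<open>\<open>A B\<close> and \<open>B A\<close> are the orthogonal projections along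
    \<open>p\<close> and along \<open>u\<close>. Their symmetry is then visible, and the other two
    Penrose conditions reduce to \<open>p^T A = 0\<close> and \<open>u^T B = 0\<close>.\<close>
  have AB: "mmul I A B i k = mid i k - p i * p k / \<beta>" if "i \<in> I" "k \<in> I" for i k
  proof -
    have "mmul I A B i k = (\<Sum>j\<in>I. A i j * C j k) - mvec I A u i * (p k / (\<alpha> * \<beta>))"
      using that by (simp add: mmul_def mvec_def B_def right_diff_distrib sum_subtractf
          sum_distrib_right sum_divide_distrib mult.assoc)
    also have "\<dots> = (\<Sum>j\<in>I. N i j * C j k) - p i * (\<Sum>j\<in>I. u j * C j k)"
      using that by (simp add: Au N_def madd_def distrib_right sum.distrib sum_distrib_left mult.assoc)
    finally show ?thesis using that by (simp add: NC uC)
  qed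
  have BA: "mmul I B A i k = mid i k - u i * u k / \<alpha>" if "i \<in> I" "k \<in> I" for i k
  proof -
    have "mmul I B A i k = (\<Sum>j\<in>I. C i j * A j k) - u i / (\<alpha> * \<beta>) * (\<Sum>j\<in>I. p j * A j k)"
      using that by (simp add: mmul_def B_def left_diff_distrib sum_subtractf
          sum_distrib_left mult.assoc)
    also have "\<dots> = (\<Sum>j\<in>I. C i j * N j k) - (\<Sum>j\<in>I. C i j * p j) * u k"
      using that by (simp add: pA' N_def madd_def distrib_left sum.distrib sum_distrib_right mult.assoc)
    finally show ?thesis using that by (simp add: CN Cp)
  qed
  have uB: "(\<Sum>j\<in>I. u j * B j k) = 0" if "k \<in> I" for k
  proof -
    have "(\<Sum>j\<in>I. u j * B j k) = (\<Sum>j\<in>I. u j * C j k) - \<alpha> * (p k / (\<alpha> * \<beta>))"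
      using that by (simp add: B_def right_diff_distrib sum_subtractf \<alpha>_def sum_distrib_right mult.assoc
          sum_divide_distrib)
    then show ?thesis using that \<alpha> \<beta> by (simp add: uC)
  qed
  have "is_pinv I A B"
    unfolding is_pinv_def
  proof (intro conjI)
    show "supported_on I I B" by (auto simp: supported_on_def B_def)
    show "eq_on I I (mtransp (mmul I A B)) (mmul I A B)"
      by (auto simp: eq_on_def mtransp_def AB) (simp add: mid_def mdiag_def)
    show "eq_on I I (mtransp (mmul I B A)) (mmul I B A)"
      by (auto simp: eq_on_def mtransp_def BA) (simp add: mid_def mdiag_def)
    have "mmul I (mmul I A B) A i k = A i k - p i / \<beta> * (\<Sum>j\<in>I. p j * A j k)"
      if "i \<in> I" "k \<in> I" for i k
      using that by (simp add: mmul_def[of I "mmul I A B"] AB left_diff_distrib sum_subtractf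
          sum_mid_left fin sum_distrib_left mult.assoc)
    then show "eq_on I I (mmul I (mmul I A B) A) A"
      by (simp add: eq_on_def pA')
    have "mmul I (mmul I B A) B i k = B i k - u i / \<alpha> * (\<Sum>j\<in>I. u j * B j k)"
      if "i \<in> I" "k \<in> I" for i k
      using that by (simp add: mmul_def[of I "mmul I B A"] BA left_diff_distrib sum_subtractf
          sum_mid_left fin sum_distrib_left mult.assoc)
    then show "eq_on I I (mmul I (mmul I B A) B) B"
      by (simp add: eq_on_def uB)
  qed
  then have "pinv I A = B" by (rule pinv_eqI[OF fin])
  \<comment> \<open>The projection \<open>A B\<close> fixes \<open>g\<close>, which is orthogonal to
    \<open>p\<close>.\<close>
  moreover have "mvec I A (mvec I B g) i = g i"
  proof -
    have "mvec I (mmul I A B) g i = (\<Sum>j\<in>I. mid i j * g j) - p i / \<beta> * (\<Sum>j\<in>I. p j * g j)"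
      using \<open>i \<in> I\<close> by (simp add: mvec_def AB left_diff_distrib sum_subtractf sum_distrib_left mult.assoc)
    then show ?thesis using \<open>i \<in> I\<close> by (simp add: mvec_mmul fin g sum_mid_left)
  qed
  ultimately show ?thesis by simp
qed

section \<open>Diagonal matrices, and the Laplacian as a sum of differences\<close>

lemma minv_mdiag:
  assumes "finite I" "\<And>i. i \<in> I \<Longrightarrow> d i \<noteq> 0"
  shows "minv I (mdiag d) = (\<lambda>i j. if i = j \<and> i \<in> I then 1 / d i else 0)"
proof (rule minv_eqI[OF assms(1)])
  have "(\<Sum>j\<in>I. mdiag d i j * (if j = k \<and> j \<in> I then 1 / d j else 0)) = mid i k"
    "(\<Sum>j\<in>I. (if i = j \<and> i \<in> I then 1 / d i else 0) * mdiag d j k) = mid i k"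
    if "i \<in> I" "k \<in> I" for i k
    using assms that
    by (auto simp: mdiag_def mid_def if_distrib[of "\<lambda>c. _ * c"] if_distrib[of "\<lambda>c. c * _"] cong: if_cong)
  then show "is_minv I (mdiag d) (\<lambda>i j. if i = j \<and> i \<in> I then 1 / d i else 0)"
    by (simp add: is_minv_def supported_on_def eq_on_def mmul_def)
qed

lemma mmul_mdiag_left: "finite I \<Longrightarrow> i \<in> I \<Longrightarrow> mmul I (mdiag d) A i j = d i * A i j"
  by (simp add: mmul_def mdiag_def if_distrib[of "\<lambda>c. c * _"] cong: if_cong)

lemma mvec_mdiag: "finite I \<Longrightarrow> i \<in> I \<Longrightarrow> mvec I (mdiag d) x i = d i * x i"
  by (simp add: mvec_def mdiag_def if_distrib[of "\<lambda>c. c * _"] cong: if_cong)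

lemma mvec_laplacian:
  assumes "finite (pverts G)" "u \<in> pverts G"
  shows "mvec (pverts G) (laplacian G w) f u = (\<Sum>v\<in>pverts G. adj G w u v * (f u - f v))"
proof -
  have "mvec (pverts G) (laplacian G w) f u
      = mvec (pverts G) (deg_mat G w) f u - (\<Sum>v\<in>pverts G. adj G w u v * f v)"
    by (simp add: laplacian_def msub_def mvec_def left_diff_distrib sum_subtractf)
  then show ?thesis
    by (simp add: deg_mat_def mvec_mdiag assms right_diff_distrib sum_subtractf sum_distrib_right)
qed

lemma sum_bvec:
  assumes "finite I" "v \<in> I" "s \<in> I"
  shows "(\<Sum>i\<in>I. bvec v s i * f i) = f v - f s"
  using assms by (simp add: bvec_def unit_vec_def left_diff_distrib sum_subtractf
      if_distrib[of "\<lambda>c. c * _"] cong: if_cong)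

section \<open>Harmonic functions on irreducible digraphs\<close>

text \<open>Two nodes are demanded because a single node without a loop is irreducible in this sense
  but has degree 0, so that \<open>D\<close> is not invertible. A leader-equivalent graph always
  contains its two leaders.\<close>

locale irreducible_digraph =
  fixes G :: "'v pair_pre_digraph" and w :: "'v \<times> 'v \<Rightarrow> real"
  assumes fin: "finite (pverts G)"
    and nontrivial: "\<exists>s\<in>pverts G. \<exists>t\<in>pverts G. s \<noteq> t"
    and adj_nonneg: "0 \<le> adj G w u v"
    and irreducible: "\<lbrakk>T \<subseteq> pverts G; T \<noteq> {};
      \<And>u v. \<lbrakk>u \<in> T; v \<in> pverts G; adj G w u v > 0\<rbrakk> \<Longrightarrow> v \<in> T\<rbrakk> \<Longrightarrow> T = pverts G"
begin

abbreviation "V \<equiv> pverts G"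
abbreviation "a \<equiv> adj G w"
abbreviation "L \<equiv> laplacian G w"

definition deg :: "'v \<Rightarrow> real" where "deg u = (\<Sum>v\<in>V. a u v)"

section \<open>Degrees and the maximum principle\<close>

lemma irreducible_predecessors:
  assumes "T \<subseteq> V" "T \<noteq> {}" "\<And>u v. \<lbrakk>v \<in> T; u \<in> V; a u v > 0\<rbrakk> \<Longrightarrow> u \<in> T"
  shows "T = V"
proof (rule ccontr)
  assume "T \<noteq> V"
  then have "V - T = V"
    using assms by (intro irreducible) auto
  then show False using assms(1,2) by auto
qed

lemma deg_pos: "u \<in> V \<Longrightarrow> deg u > 0"
proof (rule ccontr)
  assume u: "u \<in> V" and "\<not> deg u > 0"
  then have "deg u = 0"
    using sum_nonneg[of V "a u"] adj_nonneg by (force simp: deg_def)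
  then have "a u v = 0" if "v \<in> V" for v
    using that fin adj_nonneg by (simp add: deg_def sum_nonneg_eq_0_iff)
  then have "{u} = V" using u by (intro irreducible) auto
  then show False using nontrivial by (metis singletonD)
qed

text \<open>If no maximiser lay in \<open>B\<close>, harmonicity at a maximiser would make a sum of
  nonnegative terms \<open>a u v * (m - f v)\<close> vanish, so its successors would be maximisers
  too; irreducibility would spread the maximum over all of \<open>V\<close>, including
  \<open>B\<close>.\<close>

lemma maximum_principle_le:
  assumes B: "B \<subseteq> V" "B \<noteq> {}" and f0: "\<And>u. u \<in> B \<Longrightarrow> f u = 0"
    and harmonic: "\<And>u. u \<in> V - B \<Longrightarrow> mvec V L f u = 0" and "u \<in> V"
  shows "f u \<le> 0"
proof -
  define m where "m = Max (f ` V)"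
  have le: "f v \<le> m" if "v \<in> V" for v using fin that by (simp add: m_def)
  have "m \<in> f ` V" unfolding m_def using fin \<open>u \<in> V\<close> by (intro Max_in) auto
  define T where "T = {v \<in> V. f v = m}"
  have "T \<inter> B \<noteq> {}"
  proof
    assume TB: "T \<inter> B = {}"
    have "T = V"
    proof (rule irreducible)
      show "T \<subseteq> V" "T \<noteq> {}" using \<open>m \<in> f ` V\<close> by (auto simp: T_def)
      fix u v assume uv: "u \<in> T" "v \<in> V" "a u v > 0"
      then have u: "u \<in> V" "f u = m" "u \<in> V - B" using TB by (auto simp: T_def)
      have "(\<Sum>v\<in>V. a u v * (m - f v)) = 0"
        using harmonic[OF u(3)] u by (simp add: mvec_laplacian fin)
      then have "a u v * (m - f v) = 0"
        using uv le adj_nonneg by (subst (asm) sum_nonneg_eq_0_iff) (auto simp: fin)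
      then show "v \<in> T" using uv by (simp add: T_def)
    qed
    then show False using TB B by auto
  qed
  then have "m = 0" using f0 by (auto simp: T_def)
  then show ?thesis using le \<open>u \<in> V\<close> by auto
qed

lemma maximum_principle:
  assumes B: "B \<subseteq> V" "B \<noteq> {}" and f0: "\<And>u. u \<in> B \<Longrightarrow> f u = 0"
    and harmonic: "\<And>u. u \<in> V - B \<Longrightarrow> mvec V L f u = 0" and u: "u \<in> V"
  shows "f u = 0"
proof (rule antisym)
  show "f u \<le> 0" using maximum_principle_le[OF assms] .
  have "- f u \<le> 0"
  proof (rule maximum_principle_le[OF B _ _ u])
    show "mvec V L (\<lambda>u. - f u) v = 0" if "v \<in> V - B" for v
      using harmonic[OF that] by (simp add: mvec_def sum_negf)
  qed (simp add: f0)
  then show "0 \<le> f u" by simp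
qed

lemma laplacian_const: "u \<in> V \<Longrightarrow> mvec V L (\<lambda>_. c) u = 0"
  by (simp add: mvec_laplacian fin)

lemma laplacian_kernel:
  assumes "\<And>u. u \<in> V \<Longrightarrow> mvec V L f u = 0"
  shows "\<exists>c. \<forall>u\<in>V. f u = c"
proof -
  obtain s where s: "s \<in> V" using nontrivial by blast
  have "f u - f s = 0" if "u \<in> V" for u
    by (rule maximum_principle[of "{s}"]) (use that s assms in \<open>auto simp: mvec_diff laplacian_const\<close>)
  then show ?thesis by auto
qed

section \<open>The random walk and its stationary distribution\<close>

lemma walk_mat_eq: "v \<in> V \<Longrightarrow> walk_mat G w u v = a v u / deg v"
proof -
  assume "v \<in> V"
  have "minv V (deg_mat G w) = (\<lambda>i j. if i = j \<and> i \<in> V then 1 / deg i else 0)"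
    unfolding deg_mat_def deg_def[symmetric]
    by (rule minv_mdiag[OF fin]) (auto dest: deg_pos)
  then show ?thesis
    using \<open>v \<in> V\<close> fin
    by (simp add: walk_mat_def mmul_def mtransp_def if_distrib[of "\<lambda>c. _ * c"] cong: if_cong)
qed

text \<open>The identity \<open>I - W^T = D^{-1} L\<close>: walk and Laplacian have the same
  harmonic functions.\<close>

lemma id_minus_walk_eq:
  assumes "u \<in> V"
  shows "msub mid (mtransp (walk_mat G w)) u v = L u v / deg u"
  using assms deg_pos[OF assms]
  by (auto simp: msub_def mtransp_def walk_mat_eq laplacian_def deg_mat_def mid_def mdiag_def
      deg_def[symmetric] diff_divide_distrib)

text \<open>The balance equation at a zero of \<open>q\<close> is a vanishing sum of nonnegative
  terms, so zeros spread to predecessors. Both positivity and uniqueness of the stationary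
  distribution rest on this.\<close>

lemma stationary_zero:
  assumes nonneg: "\<And>v. v \<in> V \<Longrightarrow> 0 \<le> q v"
    and balance: "\<And>v. v \<in> V \<Longrightarrow> q v = mvec V (walk_mat G w) q v"
    and z: "z \<in> V" "q z = 0" and v: "v \<in> V"
  shows "q v = 0"
proof -
  define T where "T = {v \<in> V. q v = 0}"
  have "T = V"
  proof (rule irreducible_predecessors)
    show "T \<subseteq> V" "T \<noteq> {}" using z by (auto simp: T_def)
    fix u v assume uv: "v \<in> T" "u \<in> V" "a u v > 0"
    have "(\<Sum>u\<in>V. a u v / deg u * q u) = 0"
      using balance[of v] uv by (simp add: T_def mvec_def walk_mat_eq)
    moreover have "0 \<le> a u v / deg u * q u" if "u \<in> V" for u
      using that nonneg adj_nonneg[of u v] deg_pos[OF that] by simp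
    ultimately have "a u v / deg u * q u = 0"
      using uv(2) fin by (subst (asm) sum_nonneg_eq_0_iff) auto
    then show "u \<in> T" using uv deg_pos[of u] by (simp add: T_def)
  qed
  then show ?thesis using v by (auto simp: T_def)
qed

lemma sum_walk: "(\<Sum>v\<in>V. mvec V (walk_mat G w) q v) = (\<Sum>u\<in>V. q u)"
proof -
  have "(\<Sum>v\<in>V. mvec V (walk_mat G w) q v) = (\<Sum>u\<in>V. \<Sum>v\<in>V. a u v / deg u * q u)"
    unfolding mvec_def by (subst sum.swap) (simp add: walk_mat_eq)
  also have "\<dots> = (\<Sum>u\<in>V. deg u / deg u * q u)"
    by (simp only: deg_def sum_divide_distrib sum_distrib_right)
  also have "\<dots> = (\<Sum>u\<in>V. q u)"
    by (intro sum.cong) (auto dest: deg_pos)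
  finally show ?thesis .
qed

text \<open>
  As \<open>W\<close> preserves total mass, \<open>|p| \<le> W |p|\<close> is an equality for every fixed point \<open>p\<close> of \<open>W\<close>; so
  \<open>|p|\<close> is a fixed point as well, and it is positive by irreducibility.
\<close>

lemma ex_stationary: "\<exists>p. is_stationary G w p"
proof -
  obtain s where s: "s \<in> V" using nontrivial by blast
  define M where "M = msub mid (mtransp (walk_mat G w))"
  have "mvec V M (\<lambda>_. 1) i = 0" if "i \<in> V" for i
    using laplacian_const[OF that, of 1] that
    by (simp add: mvec_def M_def id_minus_walk_eq sum_divide_distrib[symmetric])
  \<comment> \<open>The constants lie in the kernel of \<open>M = I - W^T\<close>; a left null
    vector of \<open>M\<close> is a fixed point of \<open>W\<close>, of unknown sign so far.\<close>
  from left_null_vector[OF fin this s]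
  obtain p where p: "\<exists>i\<in>V. p i \<noteq> 0" "\<And>j. j \<in> V \<Longrightarrow> mvec V (mtransp M) p j = 0"
    by auto
  have p_eq: "p v = mvec V (walk_mat G w) p v" if "v \<in> V" for v
  proof -
    have "mvec V (mtransp M) p v = mvec V mid p v - mvec V (walk_mat G w) p v"
      by (simp add: M_def mtransp_def msub_def mvec_def left_diff_distrib sum_subtractf
          mid_def mdiag_def eq_commute)
    then show ?thesis using p(2)[OF that] that fin by simp
  qed
  define q where "q = (\<lambda>v. \<bar>p v\<bar>)"
  have "q v \<le> mvec V (walk_mat G w) q v" if "v \<in> V" for v
  proof -
    have "q v \<le> (\<Sum>u\<in>V. \<bar>walk_mat G w v u * p u\<bar>)"
      unfolding q_def p_eq[OF that] mvec_def by (rule sum_abs)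
    also have "\<dots> = mvec V (walk_mat G w) q v"
      unfolding mvec_def q_def
      by (intro sum.cong) (auto simp: walk_mat_eq abs_mult adj_nonneg dest: deg_pos)
    finally show ?thesis .
  qed
  then have balance: "q v = mvec V (walk_mat G w) q v" if "v \<in> V" for v
    by (rule sum_mono_inv[OF sum_walk[symmetric] _ that fin])
  have pos: "q v > 0" if "v \<in> V" for v
  proof (rule ccontr)
    assume "\<not> q v > 0"
    then have "q v = 0" by (simp add: q_def)
    from stationary_zero[OF _ balance that this] p(1) show False
      by (auto simp: q_def)
  qed
  define c where "c = (\<Sum>v\<in>V. q v)"
  have "c > 0" unfolding c_def using pos s by (intro sum_pos2[OF fin]) (auto simp: q_def)
  \<comment> \<open>Total mass 1, and the value 0 off \<open>V\<close> that
    \<open>is_stationary\<close> prescribes.\<close>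
  define r where "r = (\<lambda>v. if v \<in> V then 1 / c * q v else 0)"
  have "mvec V (walk_mat G w) r v = 1 / c * mvec V (walk_mat G w) q v" for v
    unfolding mvec_scale[symmetric] by (intro mvec_cong) (auto simp: r_def)
  moreover have "(\<Sum>v\<in>V. r v) = 1 / c * c"
    unfolding c_def r_def sum_distrib_left by (intro sum.cong) auto
  ultimately have "is_stationary G w r"
    using pos balance \<open>c > 0\<close> by (simp add: is_stationary_def) (auto simp: r_def)
  then show ?thesis by blast
qed

text \<open>For the largest \<open>t\<close> that keeps \<open>p - t q\<close> nonnegative, this
  difference is invariant and has a zero, hence vanishes on \<open>V\<close>; comparing total masses
  gives \<open>t = 1\<close>.\<close>

lemma is_stationary_unique:
  assumes p: "is_stationary G w p" and q: "is_stationary G w q"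
  shows "p = q"
proof -
  define t where "t = Min ((\<lambda>v. p v / q v) ` V)"
  have "V \<noteq> {}" using nontrivial by blast
  then have "t \<in> (\<lambda>v. p v / q v) ` V"
    unfolding t_def using fin by (intro Min_in) auto
  then obtain z where z: "z \<in> V" "t = p z / q z" by blast
  have off: "p v = 0" "q v = 0" if "v \<notin> V" for v
    using p q that unfolding is_stationary_def by blast+
  have qpos: "q v > 0" if "v \<in> V" for v using q that unfolding is_stationary_def by blast
  have t_le: "t \<le> p v / q v" if "v \<in> V" for v
    using that fin by (simp add: t_def)
  then have nonneg: "0 \<le> p v - t * q v" if "v \<in> V" for v
    using t_le[OF that] qpos[OF that] by (simp add: pos_le_divide_eq)
  have "p v - t * q v = mvec V (walk_mat G w) (\<lambda>v. p v - t * q v) v" if "v \<in> V" for v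
    using p q that by (simp add: mvec_diff mvec_scale is_stationary_def)
  moreover have "p z - t * q z = 0"
    using qpos[OF z(1)] unfolding z(2) by simp
  ultimately have "p v - t * q v = 0" if "v \<in> V" for v
    by (intro stationary_zero[where q = "\<lambda>v. p v - t * q v", OF nonneg _ z(1) _ that])
  then have eq: "p v = t * q v" if "v \<in> V" for v
    using that by simp
  then have "(\<Sum>v\<in>V. p v) = t * (\<Sum>v\<in>V. q v)"
    by (simp add: sum_distrib_left)
  moreover have "(\<Sum>v\<in>V. p v) = 1" "(\<Sum>v\<in>V. q v) = 1"
    using p q unfolding is_stationary_def by blast+
  ultimately have "t = 1" by simp
  show ?thesis
  proof
    show "p v = q v" for v
      using eq[of v] \<open>t = 1\<close> off by (cases "v \<in> V") auto
  qed
qed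

lemma is_stationary_stationary: "is_stationary G w (stationary G w)"
  unfolding stationary_def using ex_stationary is_stationary_unique by (metis theI)

text \<open>The common core of all three formulas. The factor \<open>c\<close> is
  \<open>1 / deg\<close> for \<open>I - W^T\<close>, \<open>\<pi> / deg\<close> for
  \<open>calL\<close> and 1 for the Laplacian; \<open>p\<close> is \<pi> in the first case and
  constant in the other two.\<close>

lemma potential_quotient:
  fixes X :: "('v, 'v) rmat" and g :: "'v \<Rightarrow> real"
  defines "y \<equiv> mvec V (pinv V X) g"
  assumes X: "\<And>u v. \<lbrakk>u \<in> V; v \<in> V\<rbrakk> \<Longrightarrow> X u v = c u * L u v"
    and c: "\<And>u. u \<in> V \<Longrightarrow> c u \<noteq> 0"
    and p: "\<And>j. j \<in> V \<Longrightarrow> mvec V (mtransp X) p j = 0" "\<And>u. u \<in> V \<Longrightarrow> p u \<noteq> 0"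
    and s: "s0 \<in> V" "s1 \<in> V"
    and g: "\<And>u. u \<in> V - {s0, s1} \<Longrightarrow> g u = 0" "g s1 \<noteq> 0" "(\<Sum>u\<in>V. p u * g u) = 0"
    and x: "\<And>u. u \<in> V - {s0, s1} \<Longrightarrow> mvec V L x u = 0" "x s0 = 0" "x s1 = 1"
    and v: "v \<in> V"
  shows "x v = (y v - y s0) / (y s1 - y s0)"
proof -
  have mvec_X: "mvec V X z u = c u * mvec V L z u" if "u \<in> V" for z u
    using that by (simp add: mvec_def X sum_distrib_left mult.assoc)
  have Xy: "mvec V X y u = g u" if "u \<in> V" for u
    unfolding y_def
  proof (rule corank_one_pinv[OF fin, where u = "\<lambda>_. 1" and p = p])
    show "\<exists>c. \<forall>i\<in>V. z i = c * 1" if "\<And>i. i \<in> V \<Longrightarrow> mvec V X z i = 0" for z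
      using laplacian_kernel[of z] that c by (auto simp: mvec_X)
    show "mvec V X (\<lambda>_. 1) i = 0" if "i \<in> V" for i
      using that by (simp add: mvec_X laplacian_const)
  qed (use p s g that in auto)
  have Ly: "mvec V L y u = g u / c u" if "u \<in> V" for u
    using Xy[OF that] c[OF that] by (simp add: mvec_X that field_simps)
  \<comment> \<open>The comparison is made before dividing, since it also shows that the denominator
    is nonzero: equal potentials at the leaders would make \<open>y\<close> constant, contradicting
    \<open>g s1 \<noteq> 0\<close>.\<close>
  have eq: "y u - y s0 = (y s1 - y s0) * x u" if "u \<in> V" for u
  proof -
    have "y u - y s0 - (y s1 - y s0) * x u = 0"
    proof (rule maximum_principle[of "{s0, s1}", OF _ _ _ _ that])
      show "mvec V L (\<lambda>u. y u - y s0 - (y s1 - y s0) * x u) u = 0" if "u \<in> V - {s0, s1}" for u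
        using that x(1)[OF that] g(1)[OF that] by (simp add: mvec_diff mvec_scale laplacian_const Ly)
    qed (use s x in auto)
    then show ?thesis by simp
  qed
  have "y s1 \<noteq> y s0"
  proof
    assume "y s1 = y s0"
    then have "mvec V L y s1 = mvec V L (\<lambda>_. y s0) s1"
      using eq by (intro mvec_cong) auto
    then show False using g(2) c s by (simp add: Ly laplacian_const)
  qed
  then show ?thesis using eq[OF v] by simp
qed

section \<open>The three formulas for a harmonic function with leader values 0 and 1\<close>

lemma bilin_bvec:
  assumes "v \<in> V" "s \<in> V"
  shows "bilin V (bvec v s) A b = mvec V A b v - mvec V A b s"
  unfolding bilin_def by (rule sum_bvec) (use assms fin in auto)

context
  fixes s0 s1 v :: 'v and x :: "'v \<Rightarrow> real"
  assumes s: "s0 \<in> V" "s1 \<in> V" and s_neq: "s0 \<noteq> s1"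
    and x: "\<And>u. u \<in> V - {s0, s1} \<Longrightarrow> mvec V L x u = 0" "x s0 = 0" "x s1 = 1"
    and v: "v \<in> V"
begin

lemma calR_formula:
  "x v = bilin V (bvec v s0) (calR G w) (bvec s1 s0)
    / bilin V (bvec s1 s0) (calR G w) (bvec s1 s0)"
proof -
  define \<pi> where "\<pi> = stationary G w"
  have stat: "is_stationary G w \<pi>" unfolding \<pi>_def by (rule is_stationary_stationary)
  then have pos: "\<And>v. v \<in> V \<Longrightarrow> \<pi> v > 0"
    and bal: "\<And>v. v \<in> V \<Longrightarrow> \<pi> v = mvec V (walk_mat G w) \<pi> v"
    by (auto simp: is_stationary_def)
  define M where "M = msub mid (mtransp (walk_mat G w))"
  \<comment> \<open>\<open>Pi^{-1}\<close> moves from \<open>calR\<close> to the right-hand side;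
    then \<pi> pairs with \<open>g\<close> as the constant 1 pairs with \<open>b\<close>.\<close>
  define g where "g = mvec V (minv V (Pi_mat G w)) (bvec s1 s0)"
  have g: "g u = bvec s1 s0 u / \<pi> u" if "u \<in> V" for u
  proof -
    have "minv V (Pi_mat G w) = (\<lambda>i j. if i = j \<and> i \<in> V then 1 / \<pi> i else 0)"
      unfolding Pi_mat_def \<pi>_def[symmetric]
      by (rule minv_mdiag[OF fin]) (auto dest: pos)
    then show ?thesis
      using that fin by (simp add: g_def mvec_def if_distrib[of "\<lambda>c. c * _"] cong: if_cong)
  qed
  have "mvec V (calR G w) (bvec s1 s0) = mvec V (pinv V M) g"
    by (simp add: calR_def M_def g_def mvec_mmul fin)
  moreover have "x v = (mvec V (pinv V M) g v - mvec V (pinv V M) g s0)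
      / (mvec V (pinv V M) g s1 - mvec V (pinv V M) g s0)"
  proof (rule potential_quotient[where c = "\<lambda>u. 1 / deg u" and p = \<pi>, OF _ _ _ _ s _ _ _ x v])
    show "M u v = 1 / deg u * L u v" if "u \<in> V" for u v
      using that by (simp add: M_def id_minus_walk_eq)
    show "1 / deg u \<noteq> 0" if "u \<in> V" for u using deg_pos[OF that] by simp
    show "mvec V (mtransp M) \<pi> j = 0" if "j \<in> V" for j
    proof -
      have "mvec V (mtransp M) \<pi> j = mvec V mid \<pi> j - mvec V (walk_mat G w) \<pi> j"
        by (simp add: M_def mtransp_def msub_def mvec_def left_diff_distrib sum_subtractf
            mid_def mdiag_def eq_commute)
      then show ?thesis using bal[OF that] that fin by simp
    qed
    show "\<pi> u \<noteq> 0" if "u \<in> V" for u using pos[OF that] by simp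
    show "g u = 0" if "u \<in> V - {s0, s1}" for u
      using that by (simp add: g bvec_def unit_vec_def)
    show "g s1 \<noteq> 0" using s s_neq pos[of s1] by (simp add: g bvec_def unit_vec_def)
    have "(\<Sum>u\<in>V. \<pi> u * g u) = (\<Sum>u\<in>V. bvec s1 s0 u * 1)"
    proof (intro sum.cong refl)
      show "\<pi> u * g u = bvec s1 s0 u * 1" if "u \<in> V" for u
        using pos[OF that] that by (simp add: g)
    qed
    then show "(\<Sum>u\<in>V. \<pi> u * g u) = 0" using sum_bvec[OF fin s(2,1), of "\<lambda>_. 1"] by simp
  qed
  ultimately show ?thesis using s v by (simp add: bilin_bvec)
qed

text \<open>Zero column sums make the constant 1 a left null vector, and it is orthogonal to
  \<open>b\<close> because the entries 1 and -1 cancel.\<close>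

lemma pinv_formula:
  assumes X: "\<And>u v. \<lbrakk>u \<in> V; v \<in> V\<rbrakk> \<Longrightarrow> X u v = c u * L u v"
    and c: "\<And>u. u \<in> V \<Longrightarrow> c u \<noteq> 0"
    and col: "\<And>j. j \<in> V \<Longrightarrow> (\<Sum>i\<in>V. X i j) = 0"
  shows "x v = bilin V (bvec v s0) (pinv V X) (bvec s1 s0)
    / bilin V (bvec s1 s0) (pinv V X) (bvec s1 s0)"
  unfolding bilin_bvec[OF v s(1)] bilin_bvec[OF s(2,1)]
proof (rule potential_quotient[where c = c and p = "\<lambda>_. 1", OF X c _ _ s _ _ _ x v])
  show "mvec V (mtransp X) (\<lambda>_. 1) j = 0" if "j \<in> V" for j
    using col[OF that] by (simp add: mvec_def mtransp_def)
  show "bvec s1 s0 u = 0" if "u \<in> V - {s0, s1}" for u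
    using that by (simp add: bvec_def unit_vec_def)
  show "bvec s1 s0 s1 \<noteq> 0" using s_neq by (simp add: bvec_def unit_vec_def)
  show "(\<Sum>u\<in>V. 1 * bvec s1 s0 u) = 0" using sum_bvec[OF fin s(2,1), of "\<lambda>_. 1"] by simp
qed simp_all

lemma calL_formula:
  "x v = bilin V (bvec v s0) (pinv V (calL G w)) (bvec s1 s0)
    / bilin V (bvec s1 s0) (pinv V (calL G w)) (bvec s1 s0)"
proof -
  define \<pi> where "\<pi> = stationary G w"
  have stat: "is_stationary G w \<pi>" unfolding \<pi>_def by (rule is_stationary_stationary)
  then have pos: "\<And>v. v \<in> V \<Longrightarrow> \<pi> v > 0"
    and bal: "\<And>v. v \<in> V \<Longrightarrow> \<pi> v = mvec V (walk_mat G w) \<pi> v"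
    by (auto simp: is_stationary_def)
  have calL: "calL G w u v = \<pi> u * msub mid (mtransp (walk_mat G w)) u v" if "u \<in> V" for u v
    using that fin by (simp add: calL_def Pi_mat_def \<pi>_def mmul_mdiag_left)
  show ?thesis
  proof (rule pinv_formula[where c = "\<lambda>u. \<pi> u / deg u"])
    show "calL G w u v = \<pi> u / deg u * L u v" if "u \<in> V" for u v
      using that by (simp add: calL id_minus_walk_eq)
    show "\<pi> u / deg u \<noteq> 0" if "u \<in> V" for u using pos[OF that] deg_pos[OF that] by simp
    show "(\<Sum>i\<in>V. calL G w i j) = 0" if "j \<in> V" for j
    proof -
      \<comment> \<open>Column \<open>j\<close> sums to \<open>\<pi> j - (W \<pi>) j\<close>, so
        stationarity is exactly the vanishing of the column sums.\<close>
      have "(\<Sum>i\<in>V. calL G w i j) = (\<Sum>i\<in>V. \<pi> i * mid i j) - mvec V (walk_mat G w) \<pi> j"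
        by (simp add: calL mtransp_def msub_def mvec_def right_diff_distrib sum_subtractf mult.commute)
      then show ?thesis using bal[OF that] that fin by (simp add: sum_mid_right)
    qed
  qed
qed

lemma laplacian_formula:
  assumes sym: "undirected G w"
  shows "x v = bilin V (bvec v s0) (pinv V L) (bvec s1 s0)
    / bilin V (bvec s1 s0) (pinv V L) (bvec s1 s0)"
proof (rule pinv_formula[where c = "\<lambda>_. 1"])
  show "(\<Sum>i\<in>V. L i j) = 0" if "j \<in> V" for j
  proof -
    have "(\<Sum>i\<in>V. L i j) = mvec V L (\<lambda>_. 1) j"
      unfolding mvec_def
    proof (intro sum.cong refl)
      show "L i j = L j i * 1" if "i \<in> V" for i
        using sym that \<open>j \<in> V\<close>
        by (simp add: laplacian_def msub_def deg_mat_def mdiag_def undirected_def eq_on_def mtransp_def)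
    qed
    then show ?thesis using that by (simp add: laplacian_const)
  qed
qed simp_all

end

end

section \<open>Leader networks\<close>

locale leader_network =
  fixes G :: "'a pair_pre_digraph" and w :: "'a \<times> 'a \<Rightarrow> real" and S0 S1 :: "'a set"
  assumes digraph: "pair_fin_digraph G"
    and connected: "strongly_connected (with_proj G)"
    and weight_pos: "e \<in> parcs G \<Longrightarrow> w e > 0"
    and leaders: "S0 \<subseteq> pverts G" "S1 \<subseteq> pverts G" "S0 \<inter> S1 = {}" "S0 \<noteq> {}" "S1 \<noteq> {}"
begin

abbreviation "V \<equiv> pverts G"
abbreviation "a \<equiv> adj G w"
abbreviation "L \<equiv> laplacian G w"
abbreviation "F \<equiv> followers G S0 S1"
abbreviation "S \<equiv> S0 \<union> S1"

lemma finite_V: "finite V"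
  using digraph by (rule pair_fin_digraph.pair_finite_verts)

lemma arcs_in_V: "(u, v) \<in> parcs G \<Longrightarrow> u \<in> V \<and> v \<in> V"
  using digraph by (force simp: pair_fin_digraph_def pair_wf_digraph_def)

lemma F_disjoint: "F \<inter> S = {}" and V_split: "V = F \<union> S"
  using leaders by (auto simp: followers_def)

lemma finite_F: "finite F" and finite_S: "finite S"
  using finite_V V_split by (metis finite_Un)+

lemma a_nonneg: "0 \<le> a u v"
  using weight_pos[of "(u, v)"] by (simp add: adj_def less_imp_le)

lemma a_pos_iff: "a u v > 0 \<longleftrightarrow> (u, v) \<in> parcs G"
  using weight_pos[of "(u, v)"] by (simp add: adj_def)

text \<open>Induction along a path that starts in \<open>T\<close>.\<close>

lemma successor_closed:
  assumes T: "T \<subseteq> V" "T \<noteq> {}" and closed: "\<And>u v. \<lbrakk>u \<in> T; (u, v) \<in> parcs G\<rbrakk> \<Longrightarrow> v \<in> T"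
  shows "T = V"
proof -
  interpret pair_fin_digraph G by (rule digraph)
  obtain s where s: "s \<in> T" using T by blast
  have "v \<in> T" if "v \<in> V" for v
  proof -
    have "s \<rightarrow>\<^sup>*\<^bsub>with_proj G\<^esub> v"
      using connected that s T by (auto simp: strongly_connected_def)
    then show ?thesis
      by (induction rule: reachable_induct) (use s closed in auto)
  qed
  then show ?thesis using T by blast
qed

lemma mvec_L_split: "mvec V L x u = mvec F L x u + mvec S L x u"
  unfolding mvec_def V_split using F_disjoint finite_F finite_S by (intro sum.union_disjoint)

subsection \<open>The leader-equivalent graph for absolute leaders\<close>

abbreviation "c \<equiv> contract S0 S1"
abbreviation "G\<^sub>a \<equiv> abs_graph G S0 S1"
abbreviation "w\<^sub>a \<equiv> abs_weight G w S0 S1"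

lemma contract_image: "c ` V = pverts G\<^sub>a"
  using leaders by (force simp: contract_def abs_graph_def followers_def image_iff)

lemma contract_eq_Node_iff: "v \<in> V \<Longrightarrow> c v = Node u \<longleftrightarrow> v \<in> F \<and> v = u"
  by (auto simp: contract_def followers_def)

text \<open>Absent arcs have entry 0, so the sum over parallel edges may run over all node pairs in
  a fibre of \<open>c\<close>. This removes the arc set from the later regrouping.\<close>

lemma adj_abs:
  "adj G\<^sub>a w\<^sub>a x y = (if x = y \<and> x \<in> {Lead0, Lead1} then 0
     else \<Sum>e\<in>{e \<in> V \<times> V. map_prod c c e = (x, y)}. a (fst e) (snd e))"
proof (cases "x = y \<and> x \<in> {Lead0, Lead1}")
  case True
  then show ?thesis by (auto simp: adj_def abs_graph_def)
next
  case False
  define E where "E = {e \<in> parcs G. map_prod c c e = (x, y)}"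
  have "(x, y) \<in> parcs G\<^sub>a \<longleftrightarrow> E \<noteq> {}"
    using False by (force simp: abs_graph_def E_def)
  then have "adj G\<^sub>a w\<^sub>a x y = (\<Sum>e\<in>E. w e)"
    by (auto simp: adj_def abs_weight_def E_def[symmetric])
  also have "\<dots> = (\<Sum>e\<in>{e \<in> V \<times> V. map_prod c c e = (x, y)}. a (fst e) (snd e))"
    by (rule sum.mono_neutral_cong_left) (use finite_V arcs_in_V in \<open>auto simp: E_def adj_def\<close>)
  finally show ?thesis using False by auto
qed

text \<open>Summing over the contracted nodes and then over the fibres of \<open>c\<close> is
  summing over \<open>V\<close>.\<close>

lemma mvec_laplacian_abs:
  assumes u: "u \<in> F"
  shows "mvec (pverts G\<^sub>a) (laplacian G\<^sub>a w\<^sub>a) g (Node u) = mvec V L (g \<circ> c) u"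
proof -
  have fin: "finite (pverts G\<^sub>a)" by (simp add: abs_graph_def finite_F)
  have Node_u: "Node u \<in> pverts G\<^sub>a" using u by (simp add: abs_graph_def)
  have uV: "u \<in> V" using u V_split by blast
  have cu: "c u = Node u" using uV u by (simp add: contract_eq_Node_iff)
  have adj_eq: "adj G\<^sub>a w\<^sub>a (Node u) y = (\<Sum>v\<in>{v \<in> V. c v = y}. a u v)" for y
  proof -
    have "{e \<in> V \<times> V. map_prod c c e = (Node u, y)} = Pair u ` {v \<in> V. c v = y}"
      using u uV by (auto simp: contract_eq_Node_iff)
    then show ?thesis by (auto simp: adj_abs sum.reindex inj_on_def)
  qed
  have "mvec (pverts G\<^sub>a) (laplacian G\<^sub>a w\<^sub>a) g (Node u)
      = (\<Sum>y\<in>pverts G\<^sub>a. \<Sum>v\<in>{v \<in> V. c v = y}. a u v * (g (c u) - g (c v)))"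
    using Node_u fin by (auto simp: mvec_laplacian adj_eq sum_distrib_right cu intro!: sum.cong)
  also have "\<dots> = (\<Sum>v\<in>V. a u v * (g (c u) - g (c v)))"
    by (rule sum.group) (use finite_V fin contract_image in auto)
  finally show ?thesis
    using uV finite_V by (simp add: mvec_laplacian)
qed

text \<open>The preimage of a closed set under \<open>c\<close> is closed in \<open>G\<close>: an
  arc either stays within one fibre, as do the discarded edges, or survives with positive
  weight.\<close>

sublocale abs: irreducible_digraph G\<^sub>a w\<^sub>a
proof
  show "finite (pverts G\<^sub>a)" by (simp add: abs_graph_def finite_F)
  show "\<exists>s\<in>pverts G\<^sub>a. \<exists>t\<in>pverts G\<^sub>a. s \<noteq> t" by (auto simp: abs_graph_def)
  show "0 \<le> adj G\<^sub>a w\<^sub>a u v" for u v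
    unfolding adj_abs using a_nonneg by (auto intro!: sum_nonneg)
next
  fix T assume T: "T \<subseteq> pverts G\<^sub>a" "T \<noteq> {}"
    and closed: "\<And>x y. \<lbrakk>x \<in> T; y \<in> pverts G\<^sub>a; 0 < adj G\<^sub>a w\<^sub>a x y\<rbrakk> \<Longrightarrow> y \<in> T"
  have "{u \<in> V. c u \<in> T} = V"
  proof (rule successor_closed)
    show "{u \<in> V. c u \<in> T} \<subseteq> V" by blast
    show "{u \<in> V. c u \<in> T} \<noteq> {}" using T unfolding contract_image[symmetric] by auto
    fix u v assume u: "u \<in> {u \<in> V. c u \<in> T}" and uv: "(u, v) \<in> parcs G"
    then have V: "u \<in> V" "v \<in> V" "c u \<in> T" using arcs_in_V by auto
    have "c v \<in> T"
    proof (cases "c u = c v")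
      case False
      have "0 < a (fst (u, v)) (snd (u, v))" using uv by (simp add: a_pos_iff)
      also have "\<dots> \<le> (\<Sum>e\<in>{e \<in> V \<times> V. map_prod c c e = (c u, c v)}. a (fst e) (snd e))"
        by (rule member_le_sum) (use V finite_V a_nonneg in auto)
      also have "\<dots> = adj G\<^sub>a w\<^sub>a (c u) (c v)"
        using False by (simp add: adj_abs)
      finally have "0 < adj G\<^sub>a w\<^sub>a (c u) (c v)" .
      moreover have "c v \<in> pverts G\<^sub>a"
        unfolding contract_image[symmetric] using V by blast
      ultimately show ?thesis using closed[OF V(3)] by blast
    qed (use V in simp)
    then show "v \<in> {u \<in> V. c u \<in> T}" using V by simp
  qed
  then have "c ` V \<subseteq> T" by auto
  then show "T = pverts G\<^sub>a" using T(1) by (simp add: contract_image)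
qed

text \<open>A kernel vector of \<open>L_{F,F}\<close>, extended by 0 to the leaders, is harmonic off
  them, so the maximum principle makes it vanish.\<close>

lemma abs_followers_invertible: "\<exists>B. is_minv F L B"
proof (rule is_minv_exists[OF finite_F])
  fix z u assume z: "\<And>u. u \<in> F \<Longrightarrow> mvec F L z u = 0" and u: "u \<in> F"
  define g where "g = (\<lambda>y. case y of Node v \<Rightarrow> if v \<in> F then z v else 0 | _ \<Rightarrow> 0)"
  have "g (Node u) = 0"
  proof (rule abs.maximum_principle[of "{Lead0, Lead1}"])
    fix y assume "y \<in> pverts G\<^sub>a - {Lead0, Lead1}"
    then obtain v where v: "v \<in> F" "y = Node v" by (auto simp: abs_graph_def)
    have gc: "(g \<circ> c) v = (if v \<in> F then z v else 0)" if "v \<in> V" for v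
      using that by (auto simp: g_def contract_def followers_def)
    have "mvec V L (g \<circ> c) v = mvec F L (g \<circ> c) v + mvec S L (g \<circ> c) v"
      by (rule mvec_L_split)
    also have "mvec F L (g \<circ> c) v = mvec F L z v"
      using gc V_split by (intro mvec_cong) auto
    also have "mvec S L (g \<circ> c) v = mvec S L (\<lambda>_. 0) v"
      using gc V_split F_disjoint by (intro mvec_cong) auto
    finally show "mvec (pverts G\<^sub>a) (laplacian G\<^sub>a w\<^sub>a) g y = 0"
      using v z by (simp add: mvec_laplacian_abs) (simp add: mvec_def)
  qed (use u in \<open>auto simp: abs_graph_def g_def\<close>)
  then show "z u = 0" using u by (simp add: g_def)
qed

lemma abs_steady_harmonic:
  assumes "y \<in> pverts G\<^sub>a - {Lead0, Lead1}"
  shows "mvec (pverts G\<^sub>a) (laplacian G\<^sub>a w\<^sub>a) (extend_state (abs_steady G w S0 S1)) y = 0"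
proof -
  define x where "x = abs_steady G w S0 S1"
  define h where "h = mvec S L (leader_values S1)"
  obtain u where u: "u \<in> F" "y = Node u" using assms by (auto simp: abs_graph_def)
  \<comment> \<open>On the leaders too, \<open>extend_state x \<circ> c\<close> has the values of
    \<open>x\<close>. The row at \<open>u\<close> is thus that of
    \<open>L_{F,F} x_F + L_{F,S} x_S\<close>.\<close>
  have "mvec V L (extend_state x \<circ> c) u = mvec V L x u"
    using leaders
    by (intro mvec_cong) (auto simp: contract_def x_def abs_steady_def leader_values_def)
  also have "\<dots> = mvec F L x u + mvec S L x u"
    by (rule mvec_L_split)
  also have "mvec S L x u = h u"
    unfolding h_def by (intro mvec_cong) (auto simp: x_def abs_steady_def)
  also have "mvec F L x u = mvec F L (\<lambda>v. -1 * mvec F (minv F L) h v) u"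
    using F_disjoint by (intro mvec_cong) (auto simp: x_def abs_steady_def h_def)
  also have "\<dots> = - h u"
    unfolding mvec_scale mvec_minv[OF finite_F abs_followers_invertible u(1)] by simp
  also have "- h u + h u = 0" by simp
  finally show ?thesis unfolding u(2) mvec_laplacian_abs[OF u(1)] x_def[symmetric] .
qed

lemma undirected_abs:
  assumes "undirected G w"
  shows "undirected G\<^sub>a w\<^sub>a"
proof -
  have sym: "a u v = a v u" if "u \<in> V" "v \<in> V" for u v
    using assms that by (simp add: undirected_def eq_on_def mtransp_def)
  have "(\<Sum>e\<in>{e \<in> V \<times> V. map_prod c c e = (y, x)}. a (fst e) (snd e))
      = (\<Sum>e\<in>{e \<in> V \<times> V. map_prod c c e = (x, y)}. a (fst e) (snd e))" for x y
    by (rule sum.reindex_bij_witness[of _ prod.swap prod.swap]) (use sym in auto)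
  then show ?thesis
    by (auto simp: undirected_def eq_on_def mtransp_def adj_abs)
qed

end

subsection \<open>The leader-equivalent graph for influenced leaders\<close>

locale influenced_leader_network = leader_network G w S0 S1
  for G :: "'a pair_pre_digraph" and w S0 S1 +
  fixes \<kappa> :: "'a \<Rightarrow> real"
  assumes stubborn: "v \<in> S0 \<union> S1 \<Longrightarrow> \<kappa> v > 0"
begin

abbreviation "G\<^sub>i \<equiv> infl_graph G S0 S1"
abbreviation "w\<^sub>i \<equiv> infl_weight w \<kappa>"

lemma adj_infl:
  "adj G\<^sub>i w\<^sub>i (Node u) (Node v) = a u v"
  "adj G\<^sub>i w\<^sub>i (Node u) Lead0 = (if u \<in> S0 then \<kappa> u else 0)"
  "adj G\<^sub>i w\<^sub>i (Node u) Lead1 = (if u \<in> S1 then \<kappa> u else 0)"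
  "adj G\<^sub>i w\<^sub>i Lead0 (Node u) = (if u \<in> S0 then \<kappa> u else 0)"
  "adj G\<^sub>i w\<^sub>i Lead1 (Node u) = (if u \<in> S1 then \<kappa> u else 0)"
  "adj G\<^sub>i w\<^sub>i Lead0 Lead0 = 0" "adj G\<^sub>i w\<^sub>i Lead0 Lead1 = 0"
  "adj G\<^sub>i w\<^sub>i Lead1 Lead0 = 0" "adj G\<^sub>i w\<^sub>i Lead1 Lead1 = 0"
  by (auto simp: adj_def infl_graph_def)

text \<open>With leader values 0 and 1 the new edges contribute \<open>\<kappa> u * x u\<close> on
  \<open>S0\<close> and \<open>\<kappa> u * (x u - 1)\<close> on \<open>S1\<close>. Being harmonic
  at \<open>Node u\<close> is thus row \<open>u\<close> of
  \<open>(L + E^S K) x = E^{S1} K 1\<close>.\<close>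

lemma mvec_laplacian_infl:
  assumes u: "u \<in> V"
  shows "mvec (pverts G\<^sub>i) (laplacian G\<^sub>i w\<^sub>i) g (Node u) = mvec V L (g \<circ> Node) u
    + (if u \<in> S0 then \<kappa> u * (g (Node u) - g Lead0) else 0)
    + (if u \<in> S1 then \<kappa> u * (g (Node u) - g Lead1) else 0)"
proof -
  have V': "pverts G\<^sub>i = insert Lead0 (insert Lead1 (Node ` V))" by (auto simp: infl_graph_def)
  have "(\<Sum>y\<in>pverts G\<^sub>i. f y) = f Lead0 + (f Lead1 + (\<Sum>v\<in>V. f (Node v)))" for f :: "'a lnode \<Rightarrow> real"
    unfolding V' using finite_V by (simp add: image_iff sum.reindex inj_on_def)
  moreover have "finite (pverts G\<^sub>i)" "Node u \<in> pverts G\<^sub>i"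
    using finite_V u by (auto simp: infl_graph_def)
  ultimately show ?thesis
    using u finite_V by (simp add: mvec_laplacian adj_infl)
qed

text \<open>From a new leader an edge leads back to an original node, as the leader sets are
  nonempty; strong connectivity reaches all original nodes, and from these both new leaders.\<close>

sublocale infl: irreducible_digraph G\<^sub>i w\<^sub>i
proof
  show "finite (pverts G\<^sub>i)" by (simp add: infl_graph_def finite_V)
  show "\<exists>s\<in>pverts G\<^sub>i. \<exists>t\<in>pverts G\<^sub>i. s \<noteq> t" by (auto simp: infl_graph_def)
  show "0 \<le> adj G\<^sub>i w\<^sub>i x y" for x y
    using a_nonneg stubborn
    by (cases x; cases y) (auto simp: adj_infl less_imp_le)
next
  fix T assume T: "T \<subseteq> pverts G\<^sub>i" "T \<noteq> {}"
    and closed: "\<And>x y. \<lbrakk>x \<in> T; y \<in> pverts G\<^sub>i; 0 < adj G\<^sub>i w\<^sub>i x y\<rbrakk> \<Longrightarrow> y \<in> T"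
  obtain s0 s1 where s: "s0 \<in> S0" "s1 \<in> S1" "s0 \<in> V" "s1 \<in> V" using leaders by blast
  have "{u \<in> V. Node u \<in> T} = V"
  proof (rule successor_closed)
    show "{u \<in> V. Node u \<in> T} \<subseteq> V" by blast
    obtain x where x: "x \<in> T" using T by blast
    show "{u \<in> V. Node u \<in> T} \<noteq> {}"
    proof (cases x)
      case (Node u)
      then show ?thesis using x T by (auto simp: infl_graph_def)
    next
      case Lead0
      then have "Node s0 \<in> T"
        using closed[OF x, of "Node s0"] s stubborn by (simp add: adj_infl) (simp add: infl_graph_def)
      then show ?thesis using s by blast
    next
      case Lead1
      then have "Node s1 \<in> T"
        using closed[OF x, of "Node s1"] s stubborn by (simp add: adj_infl) (simp add: infl_graph_def)
      then show ?thesis using s by blast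
    qed
    fix u v assume "u \<in> {u \<in> V. Node u \<in> T}" "(u, v) \<in> parcs G"
    then show "v \<in> {u \<in> V. Node u \<in> T}"
      using closed[of "Node u" "Node v"] arcs_in_V[of u v]
      by (simp add: adj_infl a_pos_iff) (simp add: infl_graph_def)
  qed
  then have nodes: "Node u \<in> T" if "u \<in> V" for u using that by blast
  moreover have "Lead0 \<in> T"
    using closed[OF nodes[OF s(3)], of Lead0] s stubborn by (simp add: adj_infl) (simp add: infl_graph_def)
  moreover have "Lead1 \<in> T"
    using closed[OF nodes[OF s(4)], of Lead1] s stubborn by (simp add: adj_infl) (simp add: infl_graph_def)
  ultimately show "T = pverts G\<^sub>i" using T by (auto simp: infl_graph_def)
qed

section \<open>The steady state for influenced leaders\<close>

definition infl_mat :: "('a, 'a) rmat" where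
  "infl_mat = madd L (mmul V (indicator_mat S) (mdiag \<kappa>))"

lemma mvec_indicator:
  "u \<in> V \<Longrightarrow> mvec V (mmul V (indicator_mat T) (mdiag \<kappa>)) x u = (if u \<in> T then \<kappa> u * x u else 0)"
  by (simp add: mvec_mmul finite_V indicator_mat_def mvec_mdiag)

lemma mvec_infl_mat:
  assumes "u \<in> V"
  shows "mvec V infl_mat x u = mvec V L x u + (if u \<in> S then \<kappa> u * x u else 0)"
proof -
  have "mvec V infl_mat x u = mvec V L x u + mvec V (mmul V (indicator_mat S) (mdiag \<kappa>)) x u"
    by (simp add: infl_mat_def madd_def mvec_def distrib_right sum.distrib)
  then show ?thesis using assms by (simp add: mvec_indicator)
qed

text \<open>A kernel vector, extended by 0 to the two new leaders, is harmonic off them.\<close>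

lemma infl_mat_invertible: "\<exists>B. is_minv V infl_mat B"
proof (rule is_minv_exists[OF finite_V])
  fix z u assume z: "\<And>u. u \<in> V \<Longrightarrow> mvec V infl_mat z u = 0" and u: "u \<in> V"
  define g where "g = (\<lambda>y. case y of Node v \<Rightarrow> z v | _ \<Rightarrow> 0)"
  have gN: "g \<circ> Node = z" by (auto simp: g_def)
  have "g (Node u) = 0"
  proof (rule infl.maximum_principle[of "{Lead0, Lead1}"])
    fix y assume "y \<in> pverts G\<^sub>i - {Lead0, Lead1}"
    then obtain v where v: "v \<in> V" "y = Node v" by (auto simp: infl_graph_def)
    then show "mvec (pverts G\<^sub>i) (laplacian G\<^sub>i w\<^sub>i) g y = 0"
      using z[OF v(1)] leaders(3) by (auto simp: mvec_laplacian_infl mvec_infl_mat gN) (auto simp: g_def)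
  qed (use u in \<open>auto simp: infl_graph_def g_def\<close>)
  then show "z u = 0" by (simp add: g_def)
qed

lemma infl_steady_harmonic:
  assumes "y \<in> pverts G\<^sub>i - {Lead0, Lead1}"
  shows "mvec (pverts G\<^sub>i) (laplacian G\<^sub>i w\<^sub>i) (extend_state (infl_steady G w \<kappa> S0 S1)) y = 0"
proof -
  define x where "x = infl_steady G w \<kappa> S0 S1"
  obtain u where u: "u \<in> V" "y = Node u" using assms by (auto simp: infl_graph_def)
  have "mvec V infl_mat x u = mvec V (mmul V (indicator_mat S1) (mdiag \<kappa>)) (\<lambda>_. 1) u"
    unfolding x_def infl_steady_def infl_mat_def[symmetric]
    by (rule mvec_minv[OF finite_V infl_mat_invertible u(1)])
  then have "mvec V L x u + (if u \<in> S then \<kappa> u * x u else 0) = (if u \<in> S1 then \<kappa> u else 0)"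
    using u by (simp add: mvec_infl_mat mvec_indicator)
  moreover have "extend_state x \<circ> Node = x" by auto
  ultimately show ?thesis
    using u leaders(3) by (auto simp: mvec_laplacian_infl x_def[symmetric] algebra_simps split: if_splits)
qed

lemma undirected_infl:
  assumes "undirected G w"
  shows "undirected G\<^sub>i w\<^sub>i"
proof -
  have sym: "a u v = a v u" if "u \<in> V" "v \<in> V" for u v
    using assms that by (simp add: undirected_def eq_on_def mtransp_def)
  have "adj G\<^sub>i w\<^sub>i x y = adj G\<^sub>i w\<^sub>i y x" if "x \<in> pverts G\<^sub>i" "y \<in> pverts G\<^sub>i" for x y
  proof -
    have "u \<in> V" if "Node u \<in> pverts G\<^sub>i" for u using that by (auto simp: infl_graph_def)
    then show ?thesis using that sym by (cases x; cases y) (auto simp: adj_infl)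
  qed
  then show ?thesis by (auto simp: undirected_def eq_on_def mtransp_def)
qed

end

section \<open>The steady-state formulas\<close>

theorem mainTheorem1:
  fixes G :: "'a pair_pre_digraph" and w :: "'a \<times> 'a \<Rightarrow> real"
    and S0 S1 :: "'a set" and \<kappa> :: "'a \<Rightarrow> real"
    and G' :: "'a lnode pair_pre_digraph" and w' :: "'a lnode \<times> 'a lnode \<Rightarrow> real"
    and x :: "'a lnode \<Rightarrow> real"
  assumes "pair_fin_digraph G"
    and "strongly_connected (with_proj G)"
    and "\<And>e. e \<in> parcs G \<Longrightarrow> w e > 0"
    and "S0 \<subseteq> pverts G" and "S1 \<subseteq> pverts G"
    and "S0 \<inter> S1 = {}" and "S0 \<noteq> {}" and "S1 \<noteq> {}"
    and "(G' = abs_graph G S0 S1 \<and> w' = abs_weight G w S0 S1 \<and>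
            x = extend_state (abs_steady G w S0 S1)) \<or>
         ((\<forall>v\<in>S0 \<union> S1. \<kappa> v > 0) \<and>
            G' = infl_graph G S0 S1 \<and> w' = infl_weight w \<kappa> \<and>
            x = extend_state (infl_steady G w \<kappa> S0 S1))"
  shows "(\<forall>v\<in>pverts G'.
            x v = bilin (pverts G') (bvec v Lead0) (calR G' w') (bvec Lead1 Lead0)
                    / bilin (pverts G') (bvec Lead1 Lead0) (calR G' w') (bvec Lead1 Lead0) \<and>
            x v = bilin (pverts G') (bvec v Lead0) (pinv (pverts G') (calL G' w')) (bvec Lead1 Lead0)
                    / bilin (pverts G') (bvec Lead1 Lead0) (pinv (pverts G') (calL G' w'))
                        (bvec Lead1 Lead0))
       \<and> (undirected G w \<longrightarrow> (\<forall>v\<in>pverts G'.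
            x v = bilin (pverts G') (bvec v Lead0) (pinv (pverts G') (laplacian G' w'))
                      (bvec Lead1 Lead0)
                    / bilin (pverts G') (bvec Lead1 Lead0) (pinv (pverts G') (laplacian G' w'))
                        (bvec Lead1 Lead0)))"
proof -
  interpret leader_network G w S0 S1
    using assms(1-8) by (rule leader_network.intro)
  have leads: "Lead0 \<in> pverts G'" "Lead1 \<in> pverts G'"
    using assms(9) by (auto simp: abs_graph_def infl_graph_def)
  have bc: "x Lead0 = 0" "x Lead1 = 1" using assms(9) by auto
  \<comment> \<open>Both systems are reduced to the same three facts, after which the formulas no
    longer depend on the kind of leader.\<close>
  have "irreducible_digraph G' w'
    \<and> (\<forall>u\<in>pverts G' - {Lead0, Lead1}. mvec (pverts G') (laplacian G' w') x u = 0)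
    \<and> (undirected G w \<longrightarrow> undirected G' w')"
    using assms(9)
  proof (elim disjE conjE)
    assume stubborn: "\<forall>v\<in>S0 \<union> S1. \<kappa> v > 0" and eqs: "G' = infl_graph G S0 S1" "w' = infl_weight w \<kappa>"
      "x = extend_state (infl_steady G w \<kappa> S0 S1)"
    interpret influenced_leader_network G w S0 S1 \<kappa>
      using stubborn by unfold_locales blast
    show ?thesis
      unfolding eqs
      by (intro conjI ballI impI infl.irreducible_digraph_axioms infl_steady_harmonic undirected_infl)
  next
    assume eqs: "G' = abs_graph G S0 S1" "w' = abs_weight G w S0 S1"
      "x = extend_state (abs_steady G w S0 S1)"
    show ?thesis
      unfolding eqs
      by (intro conjI ballI impI abs.irreducible_digraph_axioms abs_steady_harmonic undirected_abs)
  qed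
  then have irr: "irreducible_digraph G' w'"
    and harmonic: "\<And>u. u \<in> pverts G' - {Lead0, Lead1} \<Longrightarrow> mvec (pverts G') (laplacian G' w') x u = 0"
    and sym: "undirected G w \<Longrightarrow> undirected G' w'"
    by auto
  \<comment> \<open>\<open>lnode.distinct(5)\<close> is \<open>Lead0 \<noteq> Lead1\<close>.\<close>
  note facts = leads lnode.distinct(5) harmonic bc
  show ?thesis
  proof (intro conjI impI ballI)
    fix v assume v: "v \<in> pverts G'"
    show "x v = bilin (pverts G') (bvec v Lead0) (calR G' w') (bvec Lead1 Lead0)
        / bilin (pverts G') (bvec Lead1 Lead0) (calR G' w') (bvec Lead1 Lead0)"
      by (rule irreducible_digraph.calR_formula[OF irr facts v])
    show "x v = bilin (pverts G') (bvec v Lead0) (pinv (pverts G') (calL G' w')) (bvec Lead1 Lead0)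
        / bilin (pverts G') (bvec Lead1 Lead0) (pinv (pverts G') (calL G' w')) (bvec Lead1 Lead0)"
      by (rule irreducible_digraph.calL_formula[OF irr facts v])
    assume "undirected G w"
    then show "x v = bilin (pverts G') (bvec v Lead0) (pinv (pverts G') (laplacian G' w')) (bvec Lead1 Lead0)
        / bilin (pverts G') (bvec Lead1 Lead0) (pinv (pverts G') (laplacian G' w')) (bvec Lead1 Lead0)"
      by (intro irreducible_digraph.laplacian_formula[OF irr facts v] sym)
  qed
qed

end
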